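(* Let $f_1,f_2:\mathbb{R}^n\to\overline{\mathbb{R}}$ be proper and lower semicontinuous, and let $f=f_1+f_2$. Let $\bar x\in\operatorname{dom} f_1\cap\operatorname{dom} f_2$ and $\bar v\in\partial f(\bar x)$ be such that, for all $\bar v_1\in\partial f_1(\bar x)$ and $\bar v_2\in\partial f_2(\bar x)$ with $\bar v=\bar v_1+\bar v_2$, the function $f_i$ is variationally convex at $\bar x$ for $\bar v_i$, $i=1,2$. If the constraint qualification $$\partial^\infty f_1(\bar x)\cap\left(-\partial^\infty f_2(\bar x)\right)=\{0\}$$ is satisfied, then $f$ is variationally convex at $\bar x$ for $\bar v$.
   Context: $\overline{\mathbb{R}}=[-\infty,+\infty]$; $f$ is proper if $f>-\infty$ and $f\not\equiv+\infty$; $\operatorname{dom} f=\{x: f(x)<+\infty\}$. For $\bar x\in\operatorname{dom}f$: the regular subdifferential is $\widehat\partial f(\bar x)=\{v:\liminf_{x\to\bar x,\,x\ne\bar x}\frac{f(x)-f(\bar x)-\langle v,x-\bar x\rangle}{\|x-\bar x\|}\ge0\}$; the limiting subdifferential $\partial f(\bar x)$ is the set of limits $v=\lim v_k$ with $v_k\in\widehat\partial f(x_k)$, $x_k\to\bar x$, $f(x_k)\to f(\bar x)$; the horizon subdifferential $\partial^\infty f(\bar x)$ is the set of limits $v=\lim\lambda_kv_k$ with $\lambda_k\downarrow0$, $v_k\in\widehat\partial f(x_k)$, $x_k\to\bar x$, $f(x_k)\to f(\bar x)$. Subdifferentials are empty off $\operatorname{dom}f$. $\operatorname{gph}\partial f=\{(x,v):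 v\in\partial f(x)\}$. Variational convexity: a proper lsc $f$ is variationally convex at $\bar x\in\operatorname{dom}f$ for $\bar v\in\partial f(\bar x)$ if there exist open convex neighborhoods $U$ of $\bar x$ and $V$ of $\bar v$, a convex lsc function $\hat f:\mathbb{R}^n\to\overline{\mathbb{R}}$ with $\hat f\le f$ on $U$, and $\varepsilon>0$ such that $[U_\varepsilon\times V]\cap\operatorname{gph}\partial f=[U\times V]\cap\operatorname{gph}\partial\hat f$, where $U_\varepsilon=\{x\in U: f(x)<f(\bar x)+\varepsilon\}$, and moreover $f(x)=\hat f(x)$ for every $(x,v)$ in this common graph. *)

theory Defs
  imports "HOL-Analysis.Analysis"
begin

definition edom :: "('a \<Rightarrow> ereal) \<Rightarrow> 'a set" where
  "edom f = {x. f x < \<infinity>}"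

definition proper_fun :: "('a \<Rightarrow> ereal) \<Rightarrow> bool" where
  "proper_fun f \<longleftrightarrow> (\<forall>x. f x > -\<infinity>) \<and> edom f \<noteq> {}"

definition lsc :: "('a::topological_space \<Rightarrow> ereal) \<Rightarrow> bool" where
  "lsc f \<longleftrightarrow> (\<forall>x. f x \<le> Liminf (at x) f)"

text \<open>Convexity of an extended-real-valued function, through its epigraph, which lies in
  the product of the domain with the (finite) reals; the value minus infinity is allowed.\<close>

definition epi :: "('a \<Rightarrow> ereal) \<Rightarrow> ('a \<times> real) set" where
  "epi f = {(x, r). f x \<le> ereal r}"

definition convex_ereal :: "('a::real_vector \<Rightarrow> ereal) \<Rightarrow> bool" where
  "convex_ereal f \<longleftrightarrow> convex (epi f)"

text \<open>The difference quotient below is meaningful when \<open>f x\<close> is finite, i.e. on the domain of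
  a function that never takes the value minus infinity. The convex function in the definition
  of variational convexity is not required to be proper, but it is lsc and is finite at the
  base point (where it agrees with the proper function), and such a convex function never takes
  the value minus infinity; so the convention of \<open>ereal\<close> for opposite infinities plays no role.\<close>

definition regular_subdiff :: "('a::real_inner \<Rightarrow> ereal) \<Rightarrow> 'a \<Rightarrow> 'a set" where
  "regular_subdiff f x =
     {v. x \<in> edom f \<and>
         0 \<le> Liminf (at x) (\<lambda>y. (f y - f x - ereal (v \<bullet> (y - x))) / ereal (norm (y - x)))}"

definition limiting_subdiff :: "('a::real_inner \<Rightarrow> ereal) \<Rightarrow> 'a \<Rightarrow> 'a set" where
  "limiting_subdiff f x =
     {v. x \<in> edom f \<and>
         (\<exists>(X :: nat \<Rightarrow> 'a) (W :: nat \<Rightarrow> 'a).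
            X \<longlonglongrightarrow> x \<and> (\<lambda>k. f (X k)) \<longlonglongrightarrow> f x \<and>
            (\<forall>k. W k \<in> regular_subdiff f (X k)) \<and> W \<longlonglongrightarrow> v)}"

text \<open>Here \<open>\<lambda>\<^sub>k \<down> 0\<close> is read as \<open>\<lambda>\<^sub>k > 0\<close> and \<open>\<lambda>\<^sub>k \<rightarrow> 0\<close>. Requiring monotonicity as well would
  give the same set, by passing to a subsequence.\<close>

definition horizon_subdiff :: "('a::real_inner \<Rightarrow> ereal) \<Rightarrow> 'a \<Rightarrow> 'a set" where
  "horizon_subdiff f x =
     {v. x \<in> edom f \<and>
         (\<exists>(X :: nat \<Rightarrow> 'a) (W :: nat \<Rightarrow> 'a) (l :: nat \<Rightarrow> real).
            X \<longlonglongrightarrow> x \<and> (\<lambda>k. f (X k)) \<longlonglongrightarrow> f x \<and>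
            (\<forall>k. W k \<in> regular_subdiff f (X k)) \<and>
            (\<forall>k. 0 < l k) \<and> l \<longlonglongrightarrow> 0 \<and> (\<lambda>k. l k *\<^sub>R W k) \<longlonglongrightarrow> v)}"

definition gph_subdiff :: "('a::real_inner \<Rightarrow> ereal) \<Rightarrow> ('a \<times> 'a) set" where
  "gph_subdiff f = {(x, v). v \<in> limiting_subdiff f x}"

definition variationally_convex :: "('a::real_inner \<Rightarrow> ereal) \<Rightarrow> 'a \<Rightarrow> 'a \<Rightarrow> bool" where
  "variationally_convex f xb vb \<longleftrightarrow>
     proper_fun f \<and> lsc f \<and> xb \<in> edom f \<and> vb \<in> limiting_subdiff f xb \<and>
     (\<exists>U V fh. \<exists>\<epsilon>>0.
        open U \<and> convex U \<and> xb \<in> U \<and>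
        open V \<and> convex V \<and> vb \<in> V \<and>
        convex_ereal fh \<and> lsc fh \<and> (\<forall>x\<in>U. fh x \<le> f x) \<and>
        ({x \<in> U. f x < f xb + ereal \<epsilon>} \<times> V) \<inter> gph_subdiff f = (U \<times> V) \<inter> gph_subdiff fh \<and>
        (\<forall>(x, v) \<in> (U \<times> V) \<inter> gph_subdiff fh. f x = fh x))"

end

theory Submission
  imports Defs
begin

text \<open>Variational convexity of \<open>f\<close> at \<open>xb\<close> for \<open>vb\<close> is equivalent to a uniform subgradient
  inequality: \<open>f x \<ge> f u + v \<bullet> (x - u)\<close> for all \<open>x\<close> near \<open>xb\<close> and all regular subgradients \<open>v\<close> at \<open>u\<close>
  with \<open>(u, v)\<close> near \<open>(xb, vb)\<close> and \<open>f u\<close> near \<open>f xb\<close>. In one direction the convex function is the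
  supremum of the affine minorants; its subdifferential is monotone, so that it cannot be larger than
  that of \<open>f\<close>, which is locally maximal monotone.

  By a fuzzy sum rule, a regular subgradient of \<open>f1 + f2\<close> near \<open>vb\<close> is approximated by sums \<open>w1 + w2\<close>
  of regular subgradients of \<open>f1\<close> and \<open>f2\<close> at nearby points. The constraint qualification bounds
  these pairs, and their cluster points \<open>(v1, v2)\<close> are limiting subgradients at \<open>xb\<close> with
  \<open>v1 + v2 = vb\<close>. Hence, close enough to \<open>(xb, vb)\<close>, the subgradient inequalities for \<open>f1\<close> and \<open>f2\<close>
  hold and can be added.\<close>

subsection \<open>Lower semicontinuous functions\<close>

lemma open_Collect_if_eventually:
  assumes "\<And>x. P x \<Longrightarrow> \<forall>\<^sub>F y in nhds x. P y"
  shows "open {x. P x}"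
proof (subst open_subopen, safe)
  fix x assume "P x"
  from assms[OF this] obtain S where "open S" "x \<in> S" "\<forall>y\<in>S. P y"
    unfolding eventually_nhds by blast
  then show "\<exists>T. open T \<and> x \<in> T \<and> T \<subseteq> {x. P x}" by blast
qed

lemma lsc_iff_open: "lsc f \<longleftrightarrow> (\<forall>c. open {x. c < f x})"
proof
  assume l: "lsc f"
  show "\<forall>c. open {x. c < f x}"
  proof
    fix c
    have "\<forall>\<^sub>F y in nhds x. c < f y" if "c < f x" for x
    proof -
      have "\<forall>\<^sub>F y in at x. c < f y"
        using l that unfolding lsc_def le_Liminf_iff by blast
      then show ?thesis
        using that by (simp add: eventually_nhds_conv_at)
    qed
    then show "open {x. c < f x}"
      by (rule open_Collect_if_eventually)
  qed
next
  assume o: "\<forall>c. open {x. c < f x}"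
  show "lsc f"
    unfolding lsc_def le_Liminf_iff
    using o by (auto simp: eventually_at_topological)
qed

lemma lsc_eventually:
  assumes "lsc f" "c < f x"
  shows "\<forall>\<^sub>F y in nhds x. c < f y"
  using assms unfolding lsc_iff_open eventually_nhds by blast

lemma lsc_seq_le:
  assumes "lsc f" "X \<longlonglongrightarrow> x" "\<And>k::nat. f (X k) \<le> C k" "C \<longlonglongrightarrow> L"
  shows "f x \<le> L"
proof (rule ccontr)
  assume "\<not> f x \<le> L"
  then obtain d where d: "L < d" "d < f x"
    using dense[of L "f x"] not_le by blast
  have "\<forall>\<^sub>F k in sequentially. d < f (X k)"
    using eventually_compose_filterlim[OF lsc_eventually[OF assms(1) d(2)] assms(2)] .
  moreover have "\<forall>\<^sub>F k in sequentially. C k < d"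
    using assms(4) d(1) by (rule order_tendstoD)
  ultimately have "\<forall>\<^sub>F k in sequentially. False"
  proof eventually_elim
    case (elim k)
    then show ?case using assms(3)[of k] by (meson less_trans not_less)
  qed
  then show False by simp
qed

text \<open>Lower semicontinuity gives the lower half of the convergence for free, so a one-sided
  bound with vanishing error yields the convergence of values that the subdifferentials
  demand.\<close>

lemma lsc_attentive:
  assumes "lsc f" "X \<longlonglongrightarrow> x" "\<And>k::nat. f (X k) \<le> f x + ereal (c k)" "c \<longlonglongrightarrow> 0"
  shows "(\<lambda>k. f (X k)) \<longlonglongrightarrow> f x"
proof (rule order_tendstoI)
  fix a assume "a < f x"
  then show "\<forall>\<^sub>F k in sequentially. a < f (X k)"
    using eventually_compose_filterlim[OF lsc_eventually assms(2)] assms(1) by blast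
next
  fix a assume a: "f x < a"
  have "(\<lambda>k. ereal (c k)) \<longlonglongrightarrow> 0"
    using assms(4) by (simp add: zero_ereal_def)
  then have "(\<lambda>k. f x + ereal (c k)) \<longlonglongrightarrow> f x + 0"
    by (intro tendsto_add_ereal_general tendsto_const) auto
  then have "\<forall>\<^sub>F k in sequentially. f x + ereal (c k) < a"
    using a by (auto intro: order_tendstoD)
  then show "\<forall>\<^sub>F k in sequentially. f (X k) < a"
    by eventually_elim (use assms(3) in \<open>meson le_less_trans\<close>)
qed

text \<open>With minus infinity excluded, a finite gap is shared equally between finite summands; if
  one summand is infinite, it absorbs whatever the other leaves over.\<close>

lemma ereal_less_add_split:
  fixes u v :: ereal
  assumes "c < u + v" "u \<noteq> -\<infinity>" "v \<noteq> -\<infinity>"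
  obtains a b :: real where "c \<le> ereal (a + b)" "ereal a < u" "ereal b < v"
proof -
  have ex: "\<exists>a. ereal a < w" if "w \<noteq> -\<infinity>" for w
    using that by (cases w) (auto intro: lt_ex)
  show ?thesis
  proof (cases c)
    case PInf
    then show ?thesis using assms by simp
  next
    case MInf
    then show ?thesis using ex[OF assms(2)] ex[OF assms(3)] that by auto
  next
    case (real r)
    consider s t where "u = ereal s" "v = ereal t" | "u = \<infinity>" | "v = \<infinity>"
      using assms by (cases u; cases v) auto
    then show ?thesis
    proof cases
      case 1
      then show ?thesis
        using assms(1) real that[of "s - (s + t - r) / 2" "t - (s + t - r) / 2"]
        by (simp add: field_simps)
    next
      case 2
      then show ?thesis using ex[OF assms(3)] real that[of "r - b" b for b] by auto
    next
      case 3
      then show ?thesis using ex[OF assms(2)] real that[of a "r - a" for a] by auto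
    qed
  qed
qed

lemma lsc_add:
  assumes "lsc f" "lsc g" "\<And>x. f x \<noteq> -\<infinity>" "\<And>x. g x \<noteq> -\<infinity>"
  shows "lsc (\<lambda>x. f x + g x)"
  unfolding lsc_iff_open
proof
  fix c
  have "\<forall>\<^sub>F y in nhds x. c < f y + g y" if "c < f x + g x" for x
  proof -
    obtain a b where ab: "c \<le> ereal (a + b)" "ereal a < f x" "ereal b < g x"
      using ereal_less_add_split \<open>c < f x + g x\<close> assms(3,4) by metis
    have "\<forall>\<^sub>F y in nhds x. ereal a < f y \<and> ereal b < g y"
      using lsc_eventually ab assms(1,2) by (intro eventually_conj) auto
    then show ?thesis
    proof eventually_elim
      case (elim y)
      then have "ereal a + ereal b < f y + g y"
        using assms(3,4)[of y] by (cases "f y"; cases "g y") auto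
      then show ?case using ab(1) by simp
    qed
  qed
  then show "open {x. c < f x + g x}"
    by (rule open_Collect_if_eventually)
qed

lemma lsc_compose:
  assumes "lsc f" "continuous_on UNIV h"
  shows "lsc (\<lambda>x. f (h x))"
  unfolding lsc_iff_open
proof
  fix c
  have "open (h -` {x. c < f x})"
    using assms by (intro open_vimage) (auto simp: lsc_iff_open)
  then show "open {x. c < f (h x)}" by (simp add: vimage_def)
qed

lemma lsc_ereal:
  assumes "continuous_on UNIV q"
  shows "lsc (\<lambda>x. ereal (q x))"
  unfolding lsc_iff_open
proof
  fix c
  have "continuous_on UNIV (\<lambda>x. ereal (q x))"
    using assms by (intro continuous_on_ereal)
  then show "open {x. c < ereal (q x)}"
    by (intro open_Collect_less continuous_on_const)
qed

text \<open>Without a minimiser the open sets \<open>{x. f y < f x}\<close> with \<open>y\<close> in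
  \<open>K\<close> would cover \<open>K\<close>; in a finite subcover, the index with the smallest
  value is itself uncovered.\<close>

lemma lsc_attains_min:
  assumes "lsc f" "compact K" "K \<noteq> {}"
  shows "\<exists>x\<in>K. \<forall>y\<in>K. f x \<le> f y"
proof (rule ccontr)
  assume "\<not> ?thesis"
  then have "K \<subseteq> (\<Union>y\<in>K. {x. f y < f x})" by (force simp: not_le)
  moreover have "\<And>y. open {x. f y < f x}" using assms(1) by (simp add: lsc_iff_open)
  ultimately obtain D where D: "D \<subseteq> K" "finite D" "K \<subseteq> (\<Union>y\<in>D. {x. f y < f x})"
    using compactE_image[OF assms(2)] by metis
  then have "D \<noteq> {}" using assms(3) by auto
  then obtain m where m: "m \<in> D" "\<And>y. y \<in> D \<Longrightarrow> f m \<le> f y"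
    using ex_min_if_finite[of "f ` D"] D(2) by (auto simp: not_less)
  then show False using D(1,3) by (auto simp: not_le[symmetric])
qed

subsection \<open>Regular and convex subgradients\<close>

text \<open>Clears the denominator once and for all, infinite values of \<open>f y\<close> included,
  so that the Liminf can be traded for affine minorants with a linear error.\<close>

lemma regular_subdiff_quotient:
  fixes v :: "'a::real_inner"
  assumes "f x = ereal a" "y \<noteq> x"
  shows "ereal (-e) < (f y - f x - ereal (v \<bullet> (y - x))) / ereal (norm (y - x)) \<longleftrightarrow>
    ereal (a + v \<bullet> (y - x) - e * norm (y - x)) < f y"
proof (cases "f y")
  case (real r)
  have "norm (y - x) > 0" using assms(2) by simp
  then show ?thesis using assms(1) real by (auto simp: pos_less_divide_eq)
qed (use assms in auto)

lemma regular_subdiffD: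
  fixes v :: "'a::real_inner"
  assumes "v \<in> regular_subdiff f x" "f x = ereal a" "0 < e"
  obtains r where "0 < r"
    "\<And>y. y \<in> ball x r \<Longrightarrow> ereal (a + v \<bullet> (y - x) - e * norm (y - x)) \<le> f y"
proof -
  have "ereal (-e) < 0" using assms(3) by simp
  then have "\<forall>\<^sub>F y in at x. ereal (-e) < (f y - f x - ereal (v \<bullet> (y - x))) / ereal (norm (y - x))"
    using assms(1) unfolding regular_subdiff_def le_Liminf_iff by blast
  then obtain r where r: "0 < r" "\<And>y. y \<noteq> x \<Longrightarrow> dist y x < r \<Longrightarrow>
      ereal (-e) < (f y - f x - ereal (v \<bullet> (y - x))) / ereal (norm (y - x))"
    unfolding eventually_at by blast
  show ?thesis
  proof (rule that[OF r(1)])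
    fix y assume y: "y \<in> ball x r"
    show "ereal (a + v \<bullet> (y - x) - e * norm (y - x)) \<le> f y"
    proof (cases "y = x")
      case True
      then show ?thesis using assms(2) by simp
    next
      case False
      then show ?thesis
        using r(2)[OF False] y regular_subdiff_quotient[of f x a y e v] assms(2) False
        by (simp add: dist_commute)
    qed
  qed
qed

lemma regular_subdiffI:
  fixes v :: "'a::real_inner"
  assumes "f x = ereal a"
    and "\<And>e. 0 < e \<Longrightarrow>
      \<exists>r>0. \<forall>y\<in>ball x r. ereal (a + v \<bullet> (y - x) - e * norm (y - x)) \<le> f y"
  shows "v \<in> regular_subdiff f x"
proof -
  have "\<forall>\<^sub>F y in at x. c < (f y - f x - ereal (v \<bullet> (y - x))) / ereal (norm (y - x))"
    if c: "c < 0" for c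
  proof -
    obtain d where d: "c < ereal d" "ereal d < 0"
      using ereal_dense2[OF c] by auto
    \<comment> \<open>The hypothesis gives a non-strict bound; using it with half of the error
      \<open>- d\<close> leaves room for the strict inequality in the Liminf criterion.\<close>
    then have "0 < - d / 2" by simp
    from assms(2)[OF this] obtain r where r: "0 < r"
      "\<And>y. y \<in> ball x r \<Longrightarrow> ereal (a + v \<bullet> (y - x) - (- d / 2) * norm (y - x)) \<le> f y"
      by blast
    have "c < (f y - f x - ereal (v \<bullet> (y - x))) / ereal (norm (y - x))"
      if y: "y \<noteq> x" "dist y x < r" for y
    proof -
      have "d * norm (y - x) < d / 2 * norm (y - x)"
        using d(2) y(1) by simp
      then have "ereal (a + v \<bullet> (y - x) - (- d) * norm (y - x))
          < ereal (a + v \<bullet> (y - x) - (- d / 2) * norm (y - x))"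
        by simp
      also have "\<dots> \<le> f y" using r(2)[of y] y by (simp add: dist_commute)
      finally have "ereal (- (- d)) < (f y - f x - ereal (v \<bullet> (y - x))) / ereal (norm (y - x))"
        using regular_subdiff_quotient[of f x a y "- d" v] assms(1) y(1) by blast
      then show ?thesis using d(1) by simp
    qed
    then show ?thesis using r(1) unfolding eventually_at by blast
  qed
  then show ?thesis
    using assms(1) unfolding regular_subdiff_def le_Liminf_iff edom_def by auto
qed

text \<open>Near \<open>x\<close> a quadratic error is dominated by every linear one.\<close>

lemma proximal_imp_regular_subdiff:
  fixes v :: "'a::real_inner"
  assumes "f x = ereal a" "0 < r"
    and "\<And>y. y \<in> ball x r \<Longrightarrow> ereal (a + v \<bullet> (y - x) - C * (norm (y - x))\<^sup>2) \<le> f y"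
  shows "v \<in> regular_subdiff f x"
proof (rule regular_subdiffI[of _ _ a])
  fix e :: real assume e: "0 < e"
  \<comment> \<open>On this radius \<open>C * norm (y - x)\<close> is at most \<open>e\<close>; the
    summand 1 guards against \<open>C = 0\<close>.\<close>
  define s where "s = min r (e / (\<bar>C\<bar> + 1))"
  have "ereal (a + v \<bullet> (y - x) - e * norm (y - x)) \<le> f y" if y: "y \<in> ball x s" for y
  proof -
    have n: "norm (y - x) < r" "norm (y - x) < e / (\<bar>C\<bar> + 1)"
      using y by (auto simp: s_def dist_norm norm_minus_commute)
    have "C * norm (y - x) \<le> (\<bar>C\<bar> + 1) * norm (y - x)"
      by (intro mult_right_mono) auto
    also have "\<dots> \<le> e" using n(2) by (simp add: pos_less_divide_eq mult.commute)
    finally have "C * norm (y - x) * norm (y - x) \<le> e * norm (y - x)"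
      by (intro mult_right_mono) auto
    then have "ereal (a + v \<bullet> (y - x) - e * norm (y - x))
        \<le> ereal (a + v \<bullet> (y - x) - C * (norm (y - x))\<^sup>2)"
      by (simp add: power2_eq_square)
    also have "\<dots> \<le> f y"
      using assms(3)[of y] n(1) by (simp add: dist_norm norm_minus_commute)
    finally show ?thesis .
  qed
  moreover have "0 < s" using e assms(2) by (simp add: s_def)
  ultimately show "\<exists>r>0. \<forall>y\<in>ball x r. ereal (a + v \<bullet> (y - x) - e * norm (y - x)) \<le> f y"
    by blast
qed (use assms in auto)

text \<open>The first-order condition at a local minimiser of \<open>f + q\<close>: \<open>v\<close>
  stands for minus the gradient of \<open>q\<close> at \<open>x\<close>, and a quadratic upper
  estimate replaces differentiability of \<open>q\<close>.\<close>

lemma regular_subdiff_local_min: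
  fixes v :: "'a::real_inner"
  assumes "f x = ereal a" "0 < r"
    and min: "\<And>y. y \<in> ball x r \<Longrightarrow> f x + ereal (q x) \<le> f y + ereal (q y)"
    and q: "\<And>y. y \<in> ball x r \<Longrightarrow> q y \<le> q x - v \<bullet> (y - x) + C * (norm (y - x))\<^sup>2"
  shows "v \<in> regular_subdiff f x"
proof (rule proximal_imp_regular_subdiff[of f, OF assms(1,2)])
  fix y assume y: "y \<in> ball x r"
  show "ereal (a + v \<bullet> (y - x) - C * (norm (y - x))\<^sup>2) \<le> f y"
    using min[OF y] q[OF y] assms(1) by (cases "f y") auto
qed

lemma regular_subset_limiting_subdiff: "regular_subdiff f x \<subseteq> limiting_subdiff f x"
proof
  fix v assume v: "v \<in> regular_subdiff f x"
  then have "x \<in> edom f" by (simp add: regular_subdiff_def)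
  moreover have "\<exists>X W. X \<longlonglongrightarrow> x \<and> (\<lambda>k. f (X k)) \<longlonglongrightarrow> f x \<and>
      (\<forall>k::nat. W k \<in> regular_subdiff f (X k)) \<and> W \<longlonglongrightarrow> v"
    by (rule exI[of _ "\<lambda>_. x"], rule exI[of _ "\<lambda>_. v"]) (simp add: v)
  ultimately show "v \<in> limiting_subdiff f x"
    unfolding limiting_subdiff_def by blast
qed

section \<open>Convex functions: subgradient inequalities are global\<close>

lemma convex_erealD:
  assumes "convex_ereal f" "f x \<le> ereal a" "f y \<le> ereal b" "0 \<le> t" "t \<le> 1"
  shows "f (x + t *\<^sub>R (y - x)) \<le> ereal ((1 - t) * a + t * b)"
proof -
  have "(1 - t) *\<^sub>R (x, a) + t *\<^sub>R (y, b) \<in> epi f"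
    using assms unfolding convex_ereal_def
    by (intro convexD) (auto simp: epi_def)
  moreover have "(1 - t) *\<^sub>R (x, a) + t *\<^sub>R (y, b) =
      (x + t *\<^sub>R (y - x), (1 - t) * a + t * b)"
    by (simp add: algebra_simps)
  ultimately show ?thesis by (simp add: epi_def)
qed

text \<open>A value minus infinity at \<open>y\<close> would pull \<open>f\<close> down to
  \<open>a - 1\<close> at points of the segment arbitrarily close to \<open>x\<close>, against lower
  semicontinuity at \<open>x\<close>.\<close>

lemma convex_lsc_not_MInf:
  fixes f :: "'a::real_normed_vector \<Rightarrow> ereal"
  assumes "convex_ereal f" "lsc f" "f x = ereal a"
  shows "f y \<noteq> -\<infinity>"
proof
  assume y: "f y = -\<infinity>"
  define t where "t k = inverse (real (Suc k))" for k
  have t: "0 < t k" "t k \<le> 1" for k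
    by (simp_all add: t_def inverse_le_1_iff)
  have t0: "t \<longlonglongrightarrow> 0" unfolding t_def by (rule LIMSEQ_inverse_real_of_nat)
  have "f (x + t k *\<^sub>R (y - x)) \<le> ereal (a - 1)" for k
  proof -
    have "f x \<le> ereal a" "f y \<le> ereal (a - 1 / t k)"
      using assms(3) y by simp_all
    then have "f (x + t k *\<^sub>R (y - x)) \<le> ereal ((1 - t k) * a + t k * (a - 1 / t k))"
      by (rule convex_erealD[OF assms(1)]) (use t[of k] in \<open>simp_all add: less_imp_le\<close>)
    moreover have "(1 - t k) * a + t k * (a - 1 / t k) = a - 1"
      using t(1)[of k] by (simp add: right_diff_distrib left_diff_distrib)
    ultimately show ?thesis by simp
  qed
  moreover have "(\<lambda>k. x + t k *\<^sub>R (y - x)) \<longlonglongrightarrow> x + 0 *\<^sub>R (y - x)"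
    by (intro tendsto_intros t0)
  ultimately have "f x \<le> ereal (a - 1)"
    using lsc_seq_le[OF assms(2), of "\<lambda>k. x + t k *\<^sub>R (y - x)" x "\<lambda>_. ereal (a - 1)"] by simp
  then show False using assms(3) by simp
qed

text \<open>The local estimate is applied at \<open>x + t (y - x)\<close> and carried to
  \<open>y\<close> by convexity. Its error \<open>e * norm\<close> scales with \<open>t\<close> like
  everything else, so \<open>t\<close> cancels and \<open>e\<close> can then tend to 0.\<close>

lemma convex_regular_subdiff_le:
  fixes f :: "'a::real_inner \<Rightarrow> ereal"
  assumes "convex_ereal f" "v \<in> regular_subdiff f x" "f x = ereal a"
  shows "ereal (a + v \<bullet> (y - x)) \<le> f y"
proof (rule ereal_le_real)
  fix b assume b: "f y \<le> ereal b"
  define n where "n = norm (y - x)"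
  define p where "p = v \<bullet> (y - x)"
  have n: "0 \<le> n" by (simp add: n_def)
  then have n1: "0 < n + 1" by simp
  have le: "a + p \<le> b + e * n" if e: "0 < e" for e
  proof -
    obtain r where r: "0 < r"
      "\<And>y. y \<in> ball x r \<Longrightarrow> ereal (a + v \<bullet> (y - x) - e * norm (y - x)) \<le> f y"
      using regular_subdiffD[OF assms(2,3) e] by blast
    define t where "t = min 1 (r / (2 * (n + 1)))"
    have t: "0 < t" "t \<le> 1" using r(1) n1 by (auto simp: t_def)
    have "t * n \<le> r / (2 * (n + 1)) * n"
      unfolding t_def using n by (intro mult_right_mono) auto
    also have "\<dots> < r / (2 * (n + 1)) * (n + 1)"
      using r(1) n1 by (intro mult_strict_left_mono) auto
    also have "\<dots> = r / 2" using n1 by (simp add: divide_simps)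
    also have "\<dots> < r" using r(1) by simp
    finally have in_ball: "x + t *\<^sub>R (y - x) \<in> ball x r"
      using t(1) by (simp add: dist_norm n_def)
    have "ereal (a + t * p - e * (t * n)) \<le> f (x + t *\<^sub>R (y - x))"
      using r(2)[OF in_ball] t(1) by (simp add: n_def p_def)
    also have "\<dots> \<le> ereal ((1 - t) * a + t * b)"
      using convex_erealD[OF assms(1) _ b] assms(3) t by simp
    finally have "a + t * p - e * (t * n) \<le> (1 - t) * a + t * b" by simp
    then have "t * (a + p) \<le> t * (b + e * n)"
      by (simp add: algebra_simps)
    then show ?thesis using t(1) by simp
  qed
  have "a + p \<le> b + e" if e: "0 < e" for e
  proof -
    have "e / (n + 1) * n \<le> e / (n + 1) * (n + 1)"
      using e n1 by (intro mult_left_mono) auto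
    also have "\<dots> = e" using n1 by simp
    finally show ?thesis using le[of "e / (n + 1)"] e n1 by simp
  qed
  then have "a + p \<le> b" by (rule field_le_epsilon)
  then show "ereal (a + v \<bullet> (y - x)) \<le> ereal b" by (simp add: p_def)
qed

text \<open>This closedness property carries inequalities from regular to limiting
  subgradients.\<close>

lemma subgradient_inequality_limit:
  fixes W :: "nat \<Rightarrow> 'a::real_inner"
  assumes "X \<longlonglongrightarrow> u" "W \<longlonglongrightarrow> v" "(\<lambda>k. f (X k)) \<longlonglongrightarrow> f u" "f u = ereal a"
    and "\<forall>\<^sub>F k in sequentially. f (X k) + ereal (W k \<bullet> (x - X k)) \<le> c"
  shows "f u + ereal (v \<bullet> (x - u)) \<le> c"
proof (rule tendsto_upperbound[OF _ assms(5)])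
  have "(\<lambda>k. W k \<bullet> (x - X k)) \<longlonglongrightarrow> v \<bullet> (x - u)"
    by (intro tendsto_intros assms)
  then have "(\<lambda>k. ereal (W k \<bullet> (x - X k))) \<longlonglongrightarrow> ereal (v \<bullet> (x - u))"
    by simp
  with assms(3) show "(\<lambda>k. f (X k) + ereal (W k \<bullet> (x - X k))) \<longlonglongrightarrow> f u + ereal (v \<bullet> (x - u))"
    by (intro tendsto_add_ereal_general) (simp_all add: assms(4))
qed simp

lemma convex_limiting_subdiff_le:
  fixes f :: "'a::real_inner \<Rightarrow> ereal"
  assumes "convex_ereal f" "\<And>x. f x \<noteq> -\<infinity>" "v \<in> limiting_subdiff f u"
  shows "f u + ereal (v \<bullet> (y - u)) \<le> f y"
proof -
  obtain X W where XW: "X \<longlonglongrightarrow> u" "(\<lambda>k. f (X k)) \<longlonglongrightarrow> f u"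
      "\<And>k. W k \<in> regular_subdiff f (X k)" "W \<longlonglongrightarrow> v" and u: "f u < \<infinity>"
    using assms(3) unfolding limiting_subdiff_def edom_def by blast
  obtain a where a: "f u = ereal a" using u assms(2)[of u] by (cases "f u") auto
  have "f (X k) + ereal (W k \<bullet> (y - X k)) \<le> f y" for k
  proof -
    have "f (X k) < \<infinity>" using XW(3)[of k] by (simp add: regular_subdiff_def edom_def)
    then obtain b where b: "f (X k) = ereal b" using assms(2)[of "X k"] by (cases "f (X k)") auto
    then show ?thesis using convex_regular_subdiff_le[OF assms(1) XW(3)] by simp
  qed
  then show ?thesis
    by (intro subgradient_inequality_limit[where f=f, OF XW(1,4,2) a] always_eventually allI)
qed

subsection \<open>The uniform subgradient inequality\<close>

text \<open>Only regular subgradients occur, since these are what the fuzzy sum rule decomposes;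
  limiting ones follow by closure.\<close>

definition uniform_subgradient_inequality :: "('a::real_inner \<Rightarrow> ereal) \<Rightarrow> 'a \<Rightarrow> 'a \<Rightarrow> real \<Rightarrow> bool" where
  "uniform_subgradient_inequality f xb vb d \<longleftrightarrow>
     (\<forall>u\<in>ball xb d. \<forall>v\<in>ball vb d. f u < f xb + ereal d \<longrightarrow> v \<in> regular_subdiff f u \<longrightarrow>
       (\<forall>x\<in>ball xb d. f u + ereal (v \<bullet> (x - u)) \<le> f x))"

text \<open>The three localisation conditions are strict, so the approximating regular subgradients
  eventually satisfy them.\<close>

lemma uniform_subgradient_inequality_limiting:
  assumes "uniform_subgradient_inequality f xb vb d" "\<And>x. f x \<noteq> -\<infinity>"
    and "u \<in> ball xb d" "v \<in> ball vb d" "f u < f xb + ereal d" "v \<in> limiting_subdiff f u"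
    and "x \<in> ball xb d"
  shows "f u + ereal (v \<bullet> (x - u)) \<le> f x"
proof -
  obtain X W where XW: "X \<longlonglongrightarrow> u" "(\<lambda>k. f (X k)) \<longlonglongrightarrow> f u"
      "\<And>k. W k \<in> regular_subdiff f (X k)" "W \<longlonglongrightarrow> v" and u: "f u < \<infinity>"
    using assms(6) unfolding limiting_subdiff_def edom_def by blast
  obtain a where a: "f u = ereal a" using u assms(2)[of u] by (cases "f u") auto
  have "\<forall>\<^sub>F k in sequentially. X k \<in> ball xb d"
    using XW(1) assms(3) by (intro topological_tendstoD) auto
  moreover have "\<forall>\<^sub>F k in sequentially. W k \<in> ball vb d"
    using XW(4) assms(4) by (intro topological_tendstoD) auto
  moreover have "\<forall>\<^sub>F k in sequentially. f (X k) < f xb + ereal d"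
    using XW(2) assms(5) by (rule order_tendstoD)
  ultimately have "\<forall>\<^sub>F k in sequentially. f (X k) + ereal (W k \<bullet> (x - X k)) \<le> f x"
  proof eventually_elim
    case (elim k)
    then show ?case
      using assms(1,7) XW(3)[of k] unfolding uniform_subgradient_inequality_def by blast
  qed
  then show ?thesis
    by (rule subgradient_inequality_limit[where f=f, OF XW(1,4,2) a])
qed

text \<open>Nearby subgradients of \<open>f\<close> are subgradients of \<open>fh\<close>, for which
  the inequality is global. Equality of \<open>f\<close> and \<open>fh\<close> on the common graph
  and \<open>fh \<le> f\<close> on \<open>U\<close> bring it back to \<open>f\<close>.\<close>

lemma variationally_convex_imp_uniform:
  assumes "variationally_convex f xb vb"
  obtains d where "0 < d" "uniform_subgradient_inequality f xb vb d"
proof -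
  obtain U V fh e where e: "0 < e" and U: "open U" "convex U" "xb \<in> U"
    and V: "open V" "convex V" "vb \<in> V"
    and fh: "convex_ereal fh" "lsc fh" "\<forall>x\<in>U. fh x \<le> f x"
    and gph: "({x \<in> U. f x < f xb + ereal e} \<times> V) \<inter> gph_subdiff f = (U \<times> V) \<inter> gph_subdiff fh"
    and eq: "\<forall>(x, v) \<in> (U \<times> V) \<inter> gph_subdiff fh. f x = fh x"
    using assms unfolding variationally_convex_def by (elim conjE exE) (rule that)
  have pf: "proper_fun f" and xb: "xb \<in> edom f" "vb \<in> limiting_subdiff f xb"
    using assms by (simp_all add: variationally_convex_def)
  obtain a where a: "f xb = ereal a"
  proof -
    have "f xb < \<infinity>" "-\<infinity> < f xb"
      using xb(1) pf by (simp_all add: edom_def proper_fun_def)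
    then show ?thesis using that by (cases "f xb") simp_all
  qed
  \<comment> \<open>The base pair lies in the common graph, so \<open>fh\<close> is finite at
    \<open>xb\<close> and therefore nowhere minus infinity.\<close>
  have "(xb, vb) \<in> ({x \<in> U. f x < f xb + ereal e} \<times> V) \<inter> gph_subdiff f"
    using U V e xb a by (auto simp: gph_subdiff_def)
  then have "f xb = fh xb" using eq unfolding gph by blast
  then have fin: "\<And>x. fh x \<noteq> -\<infinity>"
    using convex_lsc_not_MInf[OF fh(1,2), of xb a] a by simp
  obtain d1 where d1: "0 < d1" "ball xb d1 \<subseteq> U" using U open_contains_ball[of U] by blast
  obtain d2 where d2: "0 < d2" "ball vb d2 \<subseteq> V" using V open_contains_ball[of V] by blast
  define d where "d = Min {d1, d2, e}"
  have d: "0 < d" "d \<le> d1" "d \<le> d2" "d \<le> e" using d1 d2 e by (auto simp: d_def)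
  have "uniform_subgradient_inequality f xb vb d"
    unfolding uniform_subgradient_inequality_def
  proof safe
    fix u v x
    assume u: "u \<in> ball xb d" and v: "v \<in> ball vb d" and fu: "f u < f xb + ereal d"
      and vr: "v \<in> regular_subdiff f u" and x: "x \<in> ball xb d"
    have "f u < f xb + ereal e" using fu d(4) a by (cases "f u") auto
    then have "(u, v) \<in> ({x \<in> U. f x < f xb + ereal e} \<times> V) \<inter> gph_subdiff f"
      using u v d d1 d2 subsetD[OF regular_subset_limiting_subdiff vr]
      by (auto simp: gph_subdiff_def subset_iff)
    then have uv: "(u, v) \<in> (U \<times> V) \<inter> gph_subdiff fh" using gph by blast
    then have "fh u + ereal (v \<bullet> (x - u)) \<le> fh x"
      by (intro convex_limiting_subdiff_le[OF fh(1) fin]) (simp add: gph_subdiff_def)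
    moreover have "x \<in> U" using x d d1 by (auto simp: subset_iff)
    ultimately show "f u + ereal (v \<bullet> (x - u)) \<le> f x"
      using bspec[OF eq uv] bspec[OF fh(3), of x] by simp
  qed
  with d(1) show ?thesis by (rule that)
qed

text \<open>Tilting by the quadratic turns every point near \<open>xb + vb\<close> into \<open>y + w\<close> with \<open>w\<close> a regular
  subgradient at \<open>y\<close>: a local form of Minty surjectivity.\<close>

lemma local_minty:
  fixes f :: "'a::euclidean_space \<Rightarrow> ereal"
  assumes "lsc f" "\<And>x. f x \<noteq> -\<infinity>" "f xb = ereal a" "0 < d"
    and sub: "\<And>x. x \<in> ball xb d \<Longrightarrow> f xb + ereal (vb \<bullet> (x - xb)) \<le> f x"
  obtains s where "0 < s" "\<And>z. dist z (xb + vb) < s \<Longrightarrow>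
    \<exists>y. y \<in> ball xb d \<and> z - y \<in> ball vb d \<and> f y < f xb + ereal d \<and> z - y \<in> regular_subdiff f y"
proof -
  \<comment> \<open>The minimiser below is within \<open>2 * s\<close> of \<open>xb\<close>. The
    bound \<open>8 * s \<le> d\<close> controls the distances, and the factor
    \<open>norm vb + 1\<close> controls the value of \<open>f\<close>.\<close>
  define s where "s = min 1 (d / (8 * (norm vb + 1)))"
  have s: "0 < s" "s \<le> 1" "8 * s \<le> d" "4 * s * (norm vb + 1) \<le> d / 2"
  proof -
    have p: "0 < norm vb + 1" by (simp add: add_nonneg_pos)
    then show "0 < s" using assms(4) by (simp add: s_def)
    show "s \<le> 1" by (simp add: s_def)
    have "s * (norm vb + 1) \<le> d / (8 * (norm vb + 1)) * (norm vb + 1)"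
      unfolding s_def using p by (intro mult_right_mono) auto
    also have "\<dots> = d / 8" using p by (simp add: divide_simps)
    finally have *: "s * (norm vb + 1) \<le> d / 8" .
    then show "4 * s * (norm vb + 1) \<le> d / 2" by simp
    have "s * 1 \<le> s * (norm vb + 1)" using \<open>0 < s\<close> by (intro mult_left_mono) auto
    then show "8 * s \<le> d" using * by simp
  qed
  have "\<exists>y. y \<in> ball xb d \<and> z - y \<in> ball vb d \<and> f y < f xb + ereal d \<and> z - y \<in> regular_subdiff f y"
    if z: "dist z (xb + vb) < s" for z
  proof -
    \<comment> \<open>The gradient of \<open>q\<close> at \<open>y\<close> is \<open>y - z\<close>,
      so an interior minimiser of \<open>f + q\<close> has \<open>z - y\<close> as a regular
      subgradient.\<close>
    define q where "q y = (norm (y - z))\<^sup>2 / 2" for y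
    have "lsc (\<lambda>y. f y + ereal (q y))"
      using assms(2) unfolding q_def
      by (intro lsc_add assms(1) lsc_ereal continuous_intros) auto
    then obtain y where y: "y \<in> cball xb (d/2)"
      "\<And>y'. y' \<in> cball xb (d/2) \<Longrightarrow> f y + ereal (q y) \<le> f y' + ereal (q y')"
      using lsc_attains_min[of "\<lambda>y. f y + ereal (q y)" "cball xb (d/2)"] assms(4) by fastforce
    define D where "D = y - xb"
    define e where "e = z - (xb + vb)"
    have e: "norm e < s" using z by (simp add: e_def dist_norm)
    have y_in: "y \<in> ball xb d" using y(1) assms(4) by simp
    have lower: "f xb + ereal (vb \<bullet> D) \<le> f y" using sub[OF y_in] by (simp add: D_def)
    have upper: "f y + ereal (q y) \<le> f xb + ereal (q xb)" using y(2)[of xb] assms(4) by simp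
    obtain b where b: "f y = ereal b" using lower upper assms(3) by (cases "f y") auto
    have yz: "y - z = D - (vb + e)" and xz: "xb - z = - (vb + e)" by (simp_all add: D_def e_def)
    have "q xb - q y = D \<bullet> (vb + e) - (norm D)\<^sup>2 / 2"
      unfolding q_def power2_norm_eq_inner yz xz
      by (simp add: inner_diff inner_add inner_commute field_simps)
    then have b_le: "b \<le> a + D \<bullet> (vb + e) - (norm D)\<^sup>2 / 2"
      using upper b assms(3) by simp
    moreover have "a + vb \<bullet> D \<le> b" using lower b assms(3) by simp
    \<comment> \<open>Minimality compared with \<open>xb\<close> and the subgradient inequality at
      \<open>xb\<close> share the term \<open>vb \<bullet> D\<close>, which cancels; only the small
      error \<open>e\<close> remains.\<close>
    ultimately have "(norm D)\<^sup>2 / 2 \<le> D \<bullet> e" by (simp add: inner_add_right inner_commute)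
    also have "\<dots> \<le> norm D * norm e" by (rule norm_cauchy_schwarz)
    finally have "norm D * norm D \<le> norm D * (2 * norm e)" by (simp add: power2_eq_square)
    then have "norm D \<le> 2 * norm e"
      by (cases "D = 0") simp_all
    then have D: "norm D < 2 * s" using e by simp
    have "norm ((z - y) - vb) = norm (e - D)" by (simp add: e_def D_def algebra_simps)
    also have "\<dots> \<le> norm e + norm D" by (rule norm_triangle_ineq4)
    finally have "z - y \<in> ball vb d" using D e s by (simp add: dist_norm norm_minus_commute)
    moreover have "f y < f xb + ereal d"
    proof -
      have "D \<bullet> (vb + e) \<le> norm D * norm (vb + e)" by (rule norm_cauchy_schwarz)
      also have "\<dots> \<le> (2 * s) * (norm vb + 1)"
        using D e s(1,2) norm_triangle_ineq[of vb e] by (intro mult_mono) auto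
      also have "\<dots> < d" using s(1,4) assms(4) by simp
      finally have "D \<bullet> (vb + e) < d" .
      moreover have "0 \<le> (norm D)\<^sup>2 / 2" by simp
      ultimately have "b < a + d" using b_le by linarith
      then show ?thesis using b assms(3) by simp
    qed
    moreover have "z - y \<in> regular_subdiff f y"
    proof (rule regular_subdiff_local_min[of f, OF b, of "d / 2 - 2 * s" q _ "1 / 2"])
      show "0 < d / 2 - 2 * s" using s(1,3) by simp
    next
      fix y' assume "y' \<in> ball y (d / 2 - 2 * s)"
      then have "norm (y' - y) < d / 2 - 2 * s" by (simp add: dist_norm norm_minus_commute)
      moreover have "norm (y' - xb) \<le> norm (y' - y) + norm D"
        using norm_triangle_ineq[of "y' - y" D] by (simp add: D_def)
      ultimately have "y' \<in> cball xb (d/2)" using D by (simp add: dist_norm norm_minus_commute)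
      then show "f y + ereal (q y) \<le> f y' + ereal (q y')" by (rule y(2))
    next
      fix y'
      have "y' - z = (y' - y) + (y - z)" by simp
      then show "q y' \<le> q y - (z - y) \<bullet> (y' - y) + 1 / 2 * (norm (y' - y))\<^sup>2"
        unfolding q_def power2_norm_eq_inner
        by (simp add: inner_diff inner_add inner_commute field_simps)
    qed
    ultimately show ?thesis using y_in b by auto
  qed
  with s(1) show ?thesis by (rule that)
qed

text \<open>The convex witness \<open>fh\<close> is the supremum of the affine minorants indexed by
  the localised graph \<open>G\<close>. The inclusion \<open>G_sub\<close> of the graphs is
  immediate; the reverse one, \<open>fh_G\<close>, uses Minty surjectivity.\<close>

lemma variationally_convexI:
  fixes f :: "'a::euclidean_space \<Rightarrow> ereal"
  assumes pf: "proper_fun f" and lsc: "lsc f" and vb: "vb \<in> limiting_subdiff f xb"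
    and d: "0 < d" and unif: "uniform_subgradient_inequality f xb vb d"
  shows "variationally_convex f xb vb"
proof -
  have fin: "f x \<noteq> -\<infinity>" for x using pf by (auto simp: proper_fun_def)
  have xb: "xb \<in> edom f" using vb by (simp add: limiting_subdiff_def)
  obtain a where a: "f xb = ereal a" using xb fin[of xb] by (cases "f xb") (simp_all add: edom_def)
  define G where "G = {(u, v). u \<in> ball xb d \<and> v \<in> ball vb d \<and> f u < f xb + ereal d \<and> v \<in> limiting_subdiff f u}"
  have sub: "f u + ereal (v \<bullet> (x - u)) \<le> f x" if "(u, v) \<in> G" "x \<in> ball xb d" for u v x
    using uniform_subgradient_inequality_limiting[OF unif fin] that by (simp add: G_def)
  have base: "(xb, vb) \<in> G" using vb d a by (simp add: G_def)
  have G_fin: "\<bar>f u\<bar> \<noteq> \<infinity>" if "(u, v) \<in> G" for u v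
    using that fin[of u] a by (cases "f u") (auto simp: G_def)
  define fh where "fh x = (SUP (u, v)\<in>G. f u + ereal (v \<bullet> (x - u)))" for x
  have fh_ge: "f u + ereal (v \<bullet> (x - u)) \<le> fh x" if "(u, v) \<in> G" for u v x
    unfolding fh_def using that by (rule SUP_upper2) simp
  have fh_le: "fh x \<le> c \<longleftrightarrow> (\<forall>(u, v)\<in>G. f u + ereal (v \<bullet> (x - u)) \<le> c)" for x c
    unfolding fh_def by (auto simp: SUP_le_iff)
  have fh_le_f: "fh x \<le> f x" if "x \<in> ball xb d" for x
    using sub that by (auto simp: fh_le)
  have fh_eq: "fh u = f u" if "(u, v) \<in> G" for u v
    using fh_ge[OF that, of u] fh_le_f[of u] that by (auto simp: G_def intro: antisym)
  have fh_fin: "fh x \<noteq> -\<infinity>" for x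
    using fh_ge[OF base, of x] a by auto
  have conv: "convex_ereal fh"
    unfolding convex_ereal_def
  proof -
    \<comment> \<open>One half-space per element of \<open>G\<close>; \<open>real_of_ereal\<close>
      is harmless because \<open>f\<close> is finite there.\<close>
    have "epi fh = (\<Inter>(u, v)\<in>G. {p. v \<bullet> fst p - snd p \<le> v \<bullet> u - real_of_ereal (f u)})"
      (is "_ = ?R")
    proof -
      have "f u + ereal (v \<bullet> (x - u)) \<le> ereal r \<longleftrightarrow> v \<bullet> x - r \<le> v \<bullet> u - real_of_ereal (f u)"
        if "(u, v) \<in> G" for u v x r
        using G_fin[OF that] by (cases "f u") (auto simp: inner_diff_right)
      then show ?thesis by (fastforce simp: epi_def fh_le)
    qed
    moreover have "convex {p. v \<bullet> fst p - snd p \<le> c}" for v :: 'a and c :: real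
    proof -
      have "{p. v \<bullet> fst p - snd p \<le> c} = {p. (v, -1) \<bullet> p \<le> c}"
        by (auto simp: inner_prod_def)
      then show ?thesis by (simp add: convex_halfspace_le)
    qed
    ultimately show "convex (epi fh)" by (auto intro!: convex_INT)
  qed
  have lsc_fh: "lsc fh"
    unfolding lsc_iff_open
  proof
    fix c
    have "{x. c < fh x} = (\<Union>(u, v)\<in>G. {x. c < f u + ereal (v \<bullet> (x - u))})"
      by (auto simp: not_le[symmetric] fh_le)
    moreover have "open {x. c < f u + ereal (v \<bullet> (x - u))}" if "(u, v) \<in> G" for u v
    proof -
      have "f u + ereal (v \<bullet> (x - u)) = ereal (real_of_ereal (f u) + v \<bullet> (x - u))" for x
        using G_fin[OF that] by (cases "f u") auto
      moreover have "lsc (\<lambda>x. ereal (real_of_ereal (f u) + v \<bullet> (x - u)))"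
        by (intro lsc_ereal continuous_intros)
      ultimately show ?thesis by (simp add: lsc_iff_open)
    qed
    ultimately show "open {x. c < fh x}" by (auto intro!: open_UN)
  qed
  have G_sub: "v \<in> limiting_subdiff fh u" if uv: "(u, v) \<in> G" for u v
  proof -
    obtain b where b: "f u = ereal b" using G_fin[OF uv] by auto
    have "v \<in> regular_subdiff fh u"
      \<comment> \<open>The affine minorant touches \<open>fh\<close> at \<open>u\<close> and is
        global, so the error constant is 0 and any radius will do.\<close>
      by (rule proximal_imp_regular_subdiff[where a=b and r=1 and C=0])
        (use fh_eq[OF uv] fh_ge[OF uv] b in auto)
    then show ?thesis using regular_subset_limiting_subdiff by blast
  qed
  obtain s where s: "0 < s" and minty: "\<And>z. dist z (xb + vb) < s \<Longrightarrow>
      \<exists>y. y \<in> ball xb d \<and> z - y \<in> ball vb d \<and> f y < f xb + ereal d \<and> z - y \<in> regular_subdiff f y"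
    using local_minty[OF lsc fin a d, of vb] sub[OF base] by metis
  have fh_G: "(x, v) \<in> G"
    if x: "x \<in> ball xb (s/2)" and v: "v \<in> ball vb (s/2)" and sv: "v \<in> limiting_subdiff fh x" for x v
  proof -
    \<comment> \<open>Write \<open>x + v = y + w\<close> with \<open>(y, w)\<close> in
      \<open>G\<close>. Both \<open>v\<close> and \<open>w\<close> are subgradients of
      \<open>fh\<close>; adding their inequalities and using \<open>w - v = x - y\<close> gives
      \<open>(x - y) \<bullet> (x - y) \<le> 0\<close>.\<close>
    have "dist (x + v) (xb + vb) \<le> dist x xb + dist v vb" by (rule dist_triangle_add)
    also have "\<dots> < s" using x v by (simp add: dist_commute)
    finally obtain y where y: "y \<in> ball xb d" "x + v - y \<in> ball vb d" "f y < f xb + ereal d"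
      "x + v - y \<in> regular_subdiff f y"
      using minty by blast
    define w where "w = x + v - y"
    have yw: "(y, w) \<in> G" using y regular_subset_limiting_subdiff by (auto simp: G_def w_def)
    have 1: "fh y + ereal (w \<bullet> (x - y)) \<le> fh x" using fh_ge[OF yw] fh_eq[OF yw] by simp
    have 2: "fh x + ereal (v \<bullet> (y - x)) \<le> fh y"
      by (rule convex_limiting_subdiff_le[OF conv fh_fin sv])
    have "\<bar>fh y\<bar> \<noteq> \<infinity>" using fh_eq[OF yw] G_fin[OF yw] by simp
    then obtain p where "fh y = ereal p" by auto
    moreover from this 2 obtain q where "fh x = ereal q" using fh_fin[of x] by (cases "fh x") auto
    ultimately have "w \<bullet> (x - y) + v \<bullet> (y - x) \<le> 0" using 1 2 by simp
    moreover have "w \<bullet> (x - y) + v \<bullet> (y - x) = (x - y) \<bullet> (x - y)"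
      by (simp add: w_def inner_diff inner_add inner_commute)
    ultimately have "x = y" by (metis antisym inner_ge_zero inner_eq_zero_iff right_minus_eq)
    then show ?thesis using yw by (simp add: w_def)
  qed
  \<comment> \<open>The bound \<open>d\<close> places pairs from the graph of \<open>f\<close> in
    \<open>G\<close>; the bound \<open>s/2\<close> makes \<open>fh_G\<close> applicable to pairs
    from the graph of \<open>fh\<close>.\<close>
  define r where "r = min d (s/2)"
  have r: "0 < r" "r \<le> d" "r \<le> s/2" using d s by (auto simp: r_def)
  have "({x \<in> ball xb r. f x < f xb + ereal d} \<times> ball vb r) \<inter> gph_subdiff f =
      (ball xb r \<times> ball vb r) \<inter> gph_subdiff fh" (is "?L = ?R")
  proof (intro subset_antisym subrelI)
    fix x v assume *: "(x, v) \<in> ?L"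
    then have "(x, v) \<in> G" using r(2) by (simp add: G_def gph_subdiff_def)
    then show "(x, v) \<in> ?R" using G_sub * by (simp add: gph_subdiff_def)
  next
    fix x v assume *: "(x, v) \<in> ?R"
    then have "(x, v) \<in> G" using r(3) by (intro fh_G) (simp_all add: gph_subdiff_def)
    then show "(x, v) \<in> ?L"
      using * by (simp add: G_def gph_subdiff_def)
  qed
  moreover have "\<forall>(x, v) \<in> (ball xb r \<times> ball vb r) \<inter> gph_subdiff fh. f x = fh x"
  proof safe
    fix x v assume "x \<in> ball xb r" "v \<in> ball vb r" "(x, v) \<in> gph_subdiff fh"
    then have "(x, v) \<in> G" using r(3) by (intro fh_G) (simp_all add: gph_subdiff_def)
    then show "f x = fh x" using fh_eq by simp
  qed
  moreover have "\<forall>x\<in>ball xb r. fh x \<le> f x" using fh_le_f r(2) by simp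
  ultimately show ?thesis
    unfolding variationally_convex_def
    using pf lsc xb vb d r(1) conv lsc_fh
    by (intro conjI exI[of _ "ball xb r"] exI[of _ "ball vb r"] exI[of _ fh] exI[of _ d]) simp_all
qed

subsection \<open>The fuzzy sum rule\<close>

text \<open>The two base points may differ, and only the sum of the subgradients is controlled: each
  of them alone may still be large.\<close>

definition near_decomposition ::
  "('a::real_inner \<Rightarrow> ereal) \<Rightarrow> ('a \<Rightarrow> ereal) \<Rightarrow> 'a \<Rightarrow> 'a \<Rightarrow> real \<Rightarrow> 'a \<Rightarrow> 'a \<Rightarrow> 'a \<Rightarrow> 'a \<Rightarrow> bool" where
  "near_decomposition f1 f2 xb vb d x1 x2 w1 w2 \<longleftrightarrow>
     dist x1 xb < d \<and> dist x2 xb < d \<and> f1 x1 < f1 xb + ereal d \<and> f2 x2 < f2 xb + ereal d \<and>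
     w1 \<in> regular_subdiff f1 x1 \<and> w2 \<in> regular_subdiff f2 x2 \<and> dist (w1 + w2) vb < d"

lemma power2_norm_expand:
  fixes x y u :: "'a::real_inner"
  shows "(norm (y - u))\<^sup>2 = (norm (x - u))\<^sup>2 + 2 * ((x - u) \<bullet> (y - x)) + (norm (y - x))\<^sup>2"
  by (simp add: power2_norm_eq_inner inner_diff inner_commute)

text \<open>The variables of \<open>f1\<close> and \<open>f2\<close> are decoupled by the penalty \<open>j |x - y|\<^sup>2 / 2\<close>. The term
  \<open>(2 c / R) |x - u|\<^sup>2\<close> keeps the minimisers inside the ball of radius \<open>R\<close>, and its gradient there
  is at most \<open>4 c\<close>.\<close>

lemma fuzzy_sum_rule:
  fixes f1 f2 :: "'a::euclidean_space \<Rightarrow> ereal"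
  assumes lsc: "lsc f1" "lsc f2" and fin: "\<And>x. f1 x \<noteq> -\<infinity>" "\<And>x. f2 x \<noteq> -\<infinity>"
    and v: "v \<in> regular_subdiff (\<lambda>x. f1 x + f2 x) u" and h: "0 < h"
  shows "\<exists>x1 x2 w1 w2. near_decomposition f1 f2 u v h x1 x2 w1 w2"
proof -
  have "f1 u + f2 u < \<infinity>" using v by (simp add: regular_subdiff_def edom_def)
  then obtain a1 a2 where a: "f1 u = ereal a1" "f2 u = ereal a2"
    using fin(1)[of u] fin(2)[of u] by (cases "f1 u"; cases "f2 u") auto
  \<comment> \<open>This makes the gradient bound \<open>4 * c\<close> equal to
    \<open>h / 2\<close>, below the tolerance for \<open>w1 + w2\<close>.\<close>
  define c where "c = h / 8"
  have c: "0 < c" using h by (simp add: c_def)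
  have au: "f1 u + f2 u = ereal (a1 + a2)" using a by simp
  obtain r0 where r0: "0 < r0" "\<And>y. y \<in> ball u r0 \<Longrightarrow>
      ereal (a1 + a2 + v \<bullet> (y - u) - c * norm (y - u)) \<le> f1 y + f2 y"
    using regular_subdiffD[OF v au c] by blast
  have near: "\<exists>r>0. \<forall>y\<in>ball u r. ereal (b - h / 4) < g y" if "lsc g" "g u = ereal b" for g b
  proof -
    have "ereal (b - h / 4) < g u" using that(2) h by simp
    then have "\<forall>\<^sub>F y in nhds u. ereal (b - h / 4) < g y" by (rule lsc_eventually[OF that(1)])
    then show ?thesis by (auto simp: eventually_nhds_metric dist_commute)
  qed
  obtain r1 where r1: "0 < r1" "\<And>y. y \<in> ball u r1 \<Longrightarrow> ereal (a1 - h / 4) < f1 y"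
    using near[OF lsc(1) a(1)] by blast
  obtain r2 where r2: "0 < r2" "\<And>y. y \<in> ball u r2 \<Longrightarrow> ereal (a2 - h / 4) < f2 y"
    using near[OF lsc(2) a(2)] by blast
  \<comment> \<open>The halves keep the closed ball inside the open balls of the three estimates;
    the last entry bounds \<open>v \<bullet> (x - u)\<close> by \<open>h / 4\<close>.\<close>
  define R where "R = Min {r0 / 2, r1 / 2, r2 / 2, h / 2, h / (4 * (norm v + 1))}"
  have nv: "0 < norm v + 1" by (simp add: add_nonneg_pos)
  have R: "0 < R" "R < r0" "R < r1" "R < r2" "R < h" "norm v * R \<le> h / 4"
  proof -
    show "0 < R" using r0 r1 r2 h nv by (simp add: R_def)
    have "R \<le> r0 / 2" "R \<le> r1 / 2" "R \<le> r2 / 2" "R \<le> h / 2" and 4: "R \<le> h / (4 * (norm v + 1))"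
      unfolding R_def by (intro Min_le; simp)+
    then show "R < r0" "R < r1" "R < r2" "R < h" using r0(1) r1(1) r2(1) h by simp_all
    have "norm v * R \<le> (norm v + 1) * (h / (4 * (norm v + 1)))"
      using 4 \<open>0 < R\<close> nv by (intro mult_mono) auto
    also have "\<dots> = h / 4" using nv by (simp add: divide_simps)
    finally show "norm v * R \<le> h / 4" .
  qed
  define K where "K = cball u R \<times> cball u R"
  have K: "compact K" "(u, u) \<in> K" using R(1) by (auto simp: K_def intro: compact_Times)
  define g where "g j x y = - (v \<bullet> (x - u)) + 2 * c / R * (norm (x - u))\<^sup>2 + real j / 2 * (norm (x - y))\<^sup>2"
    for j :: nat and x y
  define F where "F p = f1 (fst p) + f2 (snd p)" for p
  have F_fin: "F p \<noteq> -\<infinity>" for p using fin by (simp add: F_def)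
  have lscF: "lsc F"
    unfolding F_def using fin
    by (intro lsc_add lsc_compose[OF lsc(1)] lsc_compose[OF lsc(2)] continuous_intros) auto
  have "\<exists>p. p \<in> K \<and> (\<forall>p'\<in>K. F p + ereal (g j (fst p) (snd p)) \<le> F p' + ereal (g j (fst p') (snd p')))" for j
  proof -
    have "lsc (\<lambda>p. F p + ereal (g j (fst p) (snd p)))"
      unfolding g_def using F_fin
      by (intro lsc_add lscF lsc_ereal continuous_intros) auto
    moreover have "K \<noteq> {}" using K(2) by blast
    ultimately show ?thesis using lsc_attains_min[OF _ K(1)] by blast
  qed
  then have "\<exists>P. \<forall>j. P j \<in> K \<and> (\<forall>p'\<in>K. F (P j) + ereal (g j (fst (P j)) (snd (P j)))
      \<le> F p' + ereal (g j (fst p') (snd p')))"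
    by (intro choice allI)
  then obtain P where P: "\<And>j. P j \<in> K"
    "\<And>j p'. p' \<in> K \<Longrightarrow> F (P j) + ereal (g j (fst (P j)) (snd (P j))) \<le> F p' + ereal (g j (fst p') (snd p'))"
    by blast
  define X where "X j = fst (P j)" for j
  define Y where "Y j = snd (P j)" for j
  have XY_in: "dist u (X j) \<le> R" "dist u (Y j) \<le> R" for j
    using P(1)[of j] by (auto simp: K_def X_def Y_def mem_Times_iff)
  have XY_min: "f1 (X j) + f2 (Y j) + ereal (g j (X j) (Y j)) \<le> f1 x + f2 y + ereal (g j x y)"
    if "dist u x \<le> R" "dist u y \<le> R" for j x y
    using P(2)[of "(x, y)" j] that by (simp add: K_def F_def X_def Y_def)
  have low: "ereal (a1 - h / 4) < f1 (X j)" "ereal (a2 - h / 4) < f2 (Y j)" for j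
    using r1(2)[of "X j"] r2(2)[of "Y j"] XY_in[of j] R by auto
  have up: "f1 (X j) + f2 (Y j) + ereal (g j (X j) (Y j)) \<le> ereal (a1 + a2)" for j
    using XY_min[of u u j] R(1) a by (simp add: g_def)
  have ex_b: "\<exists>b1 b2. f1 (X j) = ereal b1 \<and> f2 (Y j) = ereal b2" for j
    using low[of j] up[of j] by (cases "f1 (X j)"; cases "f2 (Y j)") auto
  define b1 where "b1 j = real_of_ereal (f1 (X j))" for j
  define b2 where "b2 j = real_of_ereal (f2 (Y j))" for j
  have b: "f1 (X j) = ereal (b1 j)" "f2 (Y j) = ereal (b2 j)" for j
    using ex_b[of j] by (auto simp: b1_def b2_def)
  have low': "a1 - h / 4 < b1 j" "a2 - h / 4 < b2 j" for j using low[of j] b by simp_all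
  have up': "b1 j + b2 j + 2 * c / R * (norm (X j - u))\<^sup>2 + real j / 2 * (norm (X j - Y j))\<^sup>2
      \<le> a1 + a2 + v \<bullet> (X j - u)" for j
    using up[of j] b by (simp add: g_def)
  have vX: "v \<bullet> (X j - u) \<le> h / 4" for j
  proof -
    have "v \<bullet> (X j - u) \<le> norm v * norm (X j - u)" by (rule norm_cauchy_schwarz)
    also have "\<dots> \<le> norm v * R"
      using XY_in[of j] by (intro mult_left_mono) (simp_all add: dist_norm norm_minus_commute)
    finally show ?thesis using R(6) by simp
  qed
  have quad: "0 \<le> 2 * c / R * (norm (x - u))\<^sup>2" for x using c R(1) by simp
  have pen: "0 \<le> real j / 2 * (norm (x - y))\<^sup>2" for j and x y :: 'a by simp
  \<comment> \<open>The lower bounds on \<open>f1\<close> and \<open>f2\<close> leave the penalty a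
    budget independent of \<open>j\<close>, which forces \<open>X j\<close> and \<open>Y j\<close>
    together.\<close>
  have gap: "real j * (norm (X j - Y j))\<^sup>2 \<le> 2 * h" for j
    using up'[of j] low'[of j] vX[of j] quad[of "X j"] h by linarith
  obtain p r where p: "p \<in> K" and r: "strict_mono r" and lim: "(P \<circ> r) \<longlonglongrightarrow> p"
    using K(1) P(1) unfolding compact_def by blast
  define xs where "xs = fst p"
  have limX: "(\<lambda>k. X (r k)) \<longlonglongrightarrow> xs" and limY: "(\<lambda>k. Y (r k)) \<longlonglongrightarrow> snd p"
    using tendsto_fst[OF lim] tendsto_snd[OF lim] by (simp_all add: X_def Y_def xs_def o_def)
  have "(norm (xs - snd p))\<^sup>2 \<le> 0"
  proof (rule LIMSEQ_le)
    show "(\<lambda>k. (norm (X (r k) - Y (r k)))\<^sup>2) \<longlonglongrightarrow> (norm (xs - snd p))\<^sup>2"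
      by (intro tendsto_intros limX limY)
    have "(\<lambda>k. 2 * h * inverse (real k)) \<longlonglongrightarrow> 2 * h * 0"
      by (intro tendsto_intros lim_inverse_n)
    then show "(\<lambda>k. 2 * h * inverse (real k)) \<longlonglongrightarrow> 0" by simp
    have "(norm (X (r k) - Y (r k)))\<^sup>2 \<le> 2 * h * inverse (real k)" if "1 \<le> k" for k
    proof -
      have "real k * (norm (X (r k) - Y (r k)))\<^sup>2 \<le> real (r k) * (norm (X (r k) - Y (r k)))\<^sup>2"
        using seq_suble[OF r, of k] by (intro mult_right_mono) auto
      also have "\<dots> \<le> 2 * h" by (rule gap)
      finally show ?thesis using that by (simp add: field_simps)
    qed
    then show "\<exists>N. \<forall>k\<ge>N. (norm (X (r k) - Y (r k)))\<^sup>2 \<le> 2 * h * inverse (real k)"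
      by blast
  qed
  then have ys: "snd p = xs" by simp
  have xs_in: "dist u xs \<le> R" using p by (auto simp: K_def xs_def mem_Times_iff)
  \<comment> \<open>On the diagonal, this upper bound meets the lower bound from \<open>v\<close>
    being a regular subgradient. Comparison gives \<open>norm (xs - u) \<le> R / 2\<close>, so the
    minimisers are eventually interior.\<close>
  have "F p \<le> ereal (a1 + a2 + v \<bullet> (xs - u) - 2 * c / R * (norm (xs - u))\<^sup>2)"
  proof (rule lsc_seq_le[OF lscF lim])
    show "F ((P \<circ> r) k) \<le> ereal (a1 + a2 + v \<bullet> (X (r k) - u) - 2 * c / R * (norm (X (r k) - u))\<^sup>2)" for k
    proof -
      have "b1 (r k) + b2 (r k) \<le> a1 + a2 + v \<bullet> (X (r k) - u) - 2 * c / R * (norm (X (r k) - u))\<^sup>2"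
        using up'[of "r k"] pen[of "r k" "X (r k)" "Y (r k)"] by linarith
      then show ?thesis using b[of "r k"] by (simp add: F_def flip: X_def Y_def)
    qed
    show "(\<lambda>k. ereal (a1 + a2 + v \<bullet> (X (r k) - u) - 2 * c / R * (norm (X (r k) - u))\<^sup>2))
        \<longlonglongrightarrow> ereal (a1 + a2 + v \<bullet> (xs - u) - 2 * c / R * (norm (xs - u))\<^sup>2)"
      by (intro tendsto_ereal tendsto_intros limX)
  qed
  moreover have "ereal (a1 + a2 + v \<bullet> (xs - u) - c * norm (xs - u)) \<le> F p"
    using r0(2)[of xs] xs_in R(2) ys by (simp add: F_def flip: xs_def)
  ultimately have "ereal (a1 + a2 + v \<bullet> (xs - u) - c * norm (xs - u)) \<le>
      ereal (a1 + a2 + v \<bullet> (xs - u) - 2 * c / R * (norm (xs - u))\<^sup>2)"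
    by (rule order.trans[rotated])
  then have "2 * c / R * (norm (xs - u))\<^sup>2 \<le> c * norm (xs - u)" by simp
  then have "norm (xs - u) * norm (xs - u) \<le> norm (xs - u) * (R / 2)"
    using c R(1) by (simp add: power2_eq_square field_simps)
  then have "norm (xs - u) \<le> R / 2" by (cases "xs = u") (use R(1) in auto)
  then have "xs \<in> ball u R" using R(1) by (simp add: dist_norm norm_minus_commute)
  then have "\<forall>\<^sub>F k in sequentially. X (r k) \<in> ball u R" "\<forall>\<^sub>F k in sequentially. Y (r k) \<in> ball u R"
    using topological_tendstoD[OF limX open_ball] topological_tendstoD[OF limY open_ball] ys by simp_all
  then have "\<forall>\<^sub>F k in sequentially. X (r k) \<in> ball u R \<and> Y (r k) \<in> ball u R"
    by (rule eventually_conj)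
  then obtain j where j: "X j \<in> ball u R" "Y j \<in> ball u R"
    using eventually_happens by force
  define x y where "x = X j" and "y = Y j"
  define C where "C = 2 * c / R"
  \<comment> \<open>\<open>w1\<close> and \<open>w2\<close> are minus the partial gradients of
    \<open>g j\<close>; the penalty terms cancel in the sum, leaving
    \<open>v - (2 * C) *\<^sub>R (x - u)\<close>.\<close>
  define w1 where "w1 = v - (2 * C) *\<^sub>R (x - u) - real j *\<^sub>R (x - y)"
  define w2 where "w2 = real j *\<^sub>R (x - y)"
  have shift: "dist u z' \<le> R" if "z' \<in> ball z (R - dist u z)" for z z' :: 'a
    using that dist_triangle[of u z' z] by simp
  have "w1 \<in> regular_subdiff f1 x"
  proof (rule regular_subdiff_local_min[of f1, OF b(1)[of j, folded x_def],
        of "R - dist u x" "\<lambda>x. g j x y" _ "C + real j / 2"])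
    show "0 < R - dist u x" using j by (simp add: x_def)
    fix x' assume "x' \<in> ball x (R - dist u x)"
    then have "f1 x + f2 y + ereal (g j x y) \<le> f1 x' + f2 y + ereal (g j x' y)"
      using XY_min[of x' "Y j" j] shift XY_in(2)[of j] by (simp add: x_def y_def)
    then show "f1 x + ereal (g j x y) \<le> f1 x' + ereal (g j x' y)"
      using b[of j] by (cases "f1 x'") (auto simp: x_def y_def)
    have "g j x' y = g j x y - w1 \<bullet> (x' - x) + (C + real j / 2) * (norm (x' - x))\<^sup>2"
      unfolding g_def power2_norm_expand[of x' u x] power2_norm_expand[of x' y x] C_def[symmetric] w1_def
      by (simp add: inner_diff_left inner_diff_right algebra_simps)
    then show "g j x' y \<le> g j x y - w1 \<bullet> (x' - x) + (C + real j / 2) * (norm (x' - x))\<^sup>2"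
      by simp
  qed
  moreover have "w2 \<in> regular_subdiff f2 y"
  proof (rule regular_subdiff_local_min[of f2, OF b(2)[of j, folded y_def],
        of "R - dist u y" "\<lambda>y. g j x y" _ "real j / 2"])
    show "0 < R - dist u y" using j by (simp add: y_def)
    fix y' assume "y' \<in> ball y (R - dist u y)"
    then have "f1 x + f2 y + ereal (g j x y) \<le> f1 x + f2 y' + ereal (g j x y')"
      using XY_min[of "X j" y' j] shift XY_in(1)[of j] by (simp add: x_def y_def)
    then show "f2 y + ereal (g j x y) \<le> f2 y' + ereal (g j x y')"
      using b[of j] by (cases "f2 y'") (auto simp: x_def y_def)
    have "g j x y' = g j x y - w2 \<bullet> (y' - y) + real j / 2 * (norm (y' - y))\<^sup>2"
      unfolding g_def norm_minus_commute[of x] power2_norm_expand[of y' x y] w2_def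
      by (simp add: inner_diff_left inner_diff_right algebra_simps)
    then show "g j x y' \<le> g j x y - w2 \<bullet> (y' - y) + real j / 2 * (norm (y' - y))\<^sup>2"
      by simp
  qed
  moreover have "dist (w1 + w2) v < h"
  proof -
    have "C * norm (x - u) \<le> C * R"
      using XY_in(1)[of j] c R(1)
      by (intro mult_left_mono) (simp_all add: x_def C_def dist_norm norm_minus_commute)
    also have "\<dots> = h / 4" using R(1) by (simp add: C_def c_def)
    finally show ?thesis using c R(1) h by (simp add: w1_def w2_def dist_norm C_def)
  qed
  moreover have "dist x u < h" "dist y u < h"
    using XY_in[of j] R(5) by (simp_all add: x_def y_def dist_commute)
  \<comment> \<open>Each value is bounded above through the bound on the sum and the lower bound on
    the other value.\<close>
  moreover have "b1 j < a1 + h" "b2 j < a2 + h"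
    using up'[of j] low'[of j] vX[of j] quad[of "X j"] pen[of j "X j" "Y j"] h by linarith+
  then have "f1 x < f1 u + ereal h" "f2 y < f2 u + ereal h"
    using b[of j] a by (simp_all add: x_def y_def)
  ultimately have "near_decomposition f1 f2 u v h x y w1 w2"
    by (simp add: near_decomposition_def)
  then show ?thesis by blast
qed

subsection \<open>Sums of variationally convex functions\<close>

lemma near_decomposition_mono:
  assumes "near_decomposition f1 f2 xb vb d x1 x2 w1 w2" "d \<le> d'"
  shows "near_decomposition f1 f2 xb vb d' x1 x2 w1 w2"
proof -
  have "f1 xb + ereal d \<le> f1 xb + ereal d'" "f2 xb + ereal d \<le> f2 xb + ereal d'"
    using assms(2) by (simp_all add: add_left_mono)
  then show ?thesis
    using assms unfolding near_decomposition_def by (auto elim: less_le_trans)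
qed

text \<open>Puts decompositions with vanishing tolerance into the form of the sequences that define
  limiting and horizon subgradients.\<close>

lemma near_decomposition_seq:
  assumes "lsc f1" "lsc f2" "d \<longlonglongrightarrow> 0"
    and near: "\<And>k::nat. near_decomposition f1 f2 xb vb (d k) (X1 k) (X2 k) (W1 k) (W2 k)"
  shows "X1 \<longlonglongrightarrow> xb" "X2 \<longlonglongrightarrow> xb" "(\<lambda>k. f1 (X1 k)) \<longlonglongrightarrow> f1 xb" "(\<lambda>k. f2 (X2 k)) \<longlonglongrightarrow> f2 xb"
    "\<And>k. W1 k \<in> regular_subdiff f1 (X1 k)" "\<And>k. W2 k \<in> regular_subdiff f2 (X2 k)"
    "(\<lambda>k. W1 k + W2 k) \<longlonglongrightarrow> vb"
proof -
  note nd = near[unfolded near_decomposition_def]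
  have conv: "Z \<longlonglongrightarrow> z" if "\<And>k. dist (Z k) z < d k" for Z and z :: 'a
  proof -
    have "(\<lambda>k. dist (Z k) z) \<longlonglongrightarrow> 0"
      by (rule Lim_null_comparison[OF _ assms(3)]) (use that in \<open>simp add: less_imp_le\<close>)
    then show ?thesis by (simp add: tendsto_dist_iff[of Z])
  qed
  show X: "X1 \<longlonglongrightarrow> xb" "X2 \<longlonglongrightarrow> xb" and "(\<lambda>k. W1 k + W2 k) \<longlonglongrightarrow> vb"
    by (rule conv; use nd in blast)+
  show "(\<lambda>k. f1 (X1 k)) \<longlonglongrightarrow> f1 xb"
    by (rule lsc_attentive[OF assms(1) X(1) _ assms(3)]) (use nd less_imp_le in blast)
  show "(\<lambda>k. f2 (X2 k)) \<longlonglongrightarrow> f2 xb"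
    by (rule lsc_attentive[OF assms(2) X(2) _ assms(3)]) (use nd less_imp_le in blast)
  show "\<And>k. W1 k \<in> regular_subdiff f1 (X1 k)" "\<And>k. W2 k \<in> regular_subdiff f2 (X2 k)"
    using nd by auto
qed

lemma limiting_subdiffI:
  assumes "x \<in> edom f" "X \<longlonglongrightarrow> x" "(\<lambda>k. f (X k)) \<longlonglongrightarrow> f x"
    "\<And>k::nat. W k \<in> regular_subdiff f (X k)" "W \<longlonglongrightarrow> v"
  shows "v \<in> limiting_subdiff f x"
  using assms unfolding limiting_subdiff_def by blast

lemma horizon_subdiffI:
  assumes "x \<in> edom f" "X \<longlonglongrightarrow> x" "(\<lambda>k. f (X k)) \<longlonglongrightarrow> f x"
    "\<And>k::nat. W k \<in> regular_subdiff f (X k)"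
    "\<And>k. 0 < l k" "l \<longlonglongrightarrow> 0" "(\<lambda>k. l k *\<^sub>R W k) \<longlonglongrightarrow> v"
  shows "v \<in> horizon_subdiff f x"
  using assms unfolding horizon_subdiff_def by blast

text \<open>If \<open>w1\<close> could blow up, dividing by its norm would give in the limit a unit
  vector \<open>e\<close> in the horizon subdifferential of \<open>f1\<close>. As
  \<open>w1 + w2\<close> stays bounded, the scaled \<open>w2\<close> tends to \<open>- e\<close>,
  against the constraint qualification.\<close>

lemma near_decomposition_bounded:
  fixes f1 f2 :: "'a::euclidean_space \<Rightarrow> ereal"
  assumes lsc: "lsc f1" "lsc f2" and dom: "xb \<in> edom f1" "xb \<in> edom f2"
    and cq: "horizon_subdiff f1 xb \<inter> uminus ` horizon_subdiff f2 xb = {0}"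
  shows "\<exists>d>0. \<exists>M. \<forall>x1 x2 w1 w2. near_decomposition f1 f2 xb vb d x1 x2 w1 w2 \<longrightarrow> norm w1 \<le> M"
proof (rule ccontr)
  assume neg: "\<not> ?thesis"
  define d where "d k = inverse (real (Suc k))" for k
  have d0: "d \<longlonglongrightarrow> 0" unfolding d_def by (rule LIMSEQ_inverse_real_of_nat)
  have d_pos: "0 < d k" for k by (simp add: d_def)
  have "\<exists>x1 x2 w1 w2. near_decomposition f1 f2 xb vb (d k) x1 x2 w1 w2 \<and> \<not> norm w1 \<le> real (Suc k)" for k
    using neg d_pos[of k] by blast
  then obtain X1 X2 W1 W2 where near: "\<And>k. near_decomposition f1 f2 xb vb (d k) (X1 k) (X2 k) (W1 k) (W2 k)"
      and big: "\<And>k. real (Suc k) < norm (W1 k)"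
    unfolding not_le by metis
  note lims = near_decomposition_seq[OF lsc d0 near]
  define l where "l k = inverse (norm (W1 k))" for k
  have W1_pos: "0 < norm (W1 k)" for k using big[of k] by (meson less_trans of_nat_0_less_iff zero_less_Suc)
  have l_pos: "0 < l k" for k using W1_pos by (simp add: l_def)
  have l_le: "l k \<le> d k" for k
    unfolding l_def d_def using big[of k] by (intro le_imp_inverse_le) auto
  have l0: "l \<longlonglongrightarrow> 0"
    by (rule real_tendsto_sandwich[OF _ _ tendsto_const d0])
      (auto intro!: always_eventually less_imp_le[OF l_pos] l_le)
  have "bounded (range (\<lambda>k. l k *\<^sub>R W1 k))"
    using W1_pos by (intro boundedI[of _ 1]) (auto simp: l_def)
  then obtain e r where r: "strict_mono r" and e: "((\<lambda>k. l k *\<^sub>R W1 k) \<circ> r) \<longlonglongrightarrow> e"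
    using bounded_imp_convergent_subsequence by blast
  have e1: "(\<lambda>k. l (r k) *\<^sub>R W1 (r k)) \<longlonglongrightarrow> e" using e by (simp add: o_def)
  have "(\<lambda>k. norm (l (r k) *\<^sub>R W1 (r k))) \<longlonglongrightarrow> norm e" using e1 by (rule tendsto_norm)
  moreover have "norm (l (r k) *\<^sub>R W1 (r k)) = 1" for k using W1_pos[of "r k"] by (simp add: l_def)
  ultimately have "norm e = 1" using LIMSEQ_unique[OF tendsto_const, of 1 "norm e"] by simp
  note sub = LIMSEQ_subseq_LIMSEQ[OF _ r, unfolded o_def]
  have "e \<in> horizon_subdiff f1 xb"
    by (rule horizon_subdiffI[OF dom(1) sub[OF lims(1)] sub[OF lims(3)] lims(5) l_pos sub[OF l0] e1])
  moreover have "(\<lambda>k. l (r k) *\<^sub>R (W1 (r k) + W2 (r k)) - l (r k) *\<^sub>R W1 (r k)) \<longlonglongrightarrow> 0 *\<^sub>R vb - e"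
    by (intro tendsto_intros e1 sub[OF l0] sub[OF lims(7)])
  then have "(\<lambda>k. l (r k) *\<^sub>R W2 (r k)) \<longlonglongrightarrow> - e" by (simp add: scaleR_add_right)
  then have "- e \<in> horizon_subdiff f2 xb"
    by (rule horizon_subdiffI[OF dom(2) sub[OF lims(2)] sub[OF lims(4)] lims(6) l_pos sub[OF l0]])
  then have "e \<in> uminus ` horizon_subdiff f2 xb" by (metis imageI minus_minus)
  ultimately have "e = 0" using cq by blast
  with \<open>norm e = 1\<close> show False by simp
qed

text \<open>The radius provided by variational convexity depends on the splitting
  \<open>v1 + v2\<close> of \<open>vb\<close>. Compactness makes it uniform: counterexamples with
  shrinking tolerance cluster at one splitting, where the radius is positive.\<close>

lemma near_decomposition_subgradient_inequality:
  fixes f1 f2 :: "'a::euclidean_space \<Rightarrow> ereal"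
  assumes lsc: "lsc f1" "lsc f2" and dom: "xb \<in> edom f1" "xb \<in> edom f2"
    and fin: "\<And>x. f1 x \<noteq> -\<infinity>" "\<And>x. f2 x \<noteq> -\<infinity>"
    and vc: "\<And>v1 v2. v1 \<in> limiting_subdiff f1 xb \<Longrightarrow> v2 \<in> limiting_subdiff f2 xb \<Longrightarrow> vb = v1 + v2 \<Longrightarrow>
           variationally_convex f1 xb v1 \<and> variationally_convex f2 xb v2"
    and d0: "0 < d0" and bound:
      "\<And>x1 x2 w1 w2. near_decomposition f1 f2 xb vb d0 x1 x2 w1 w2 \<Longrightarrow> norm w1 \<le> M"
  shows "\<exists>d>0. \<forall>x1 x2 w1 w2. near_decomposition f1 f2 xb vb d x1 x2 w1 w2 \<longrightarrow>
    (\<forall>x\<in>ball xb d. f1 x1 + ereal (w1 \<bullet> (x - x1)) \<le> f1 x \<and> f2 x2 + ereal (w2 \<bullet> (x - x2)) \<le> f2 x)"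
proof (rule ccontr)
  assume neg: "\<not> ?thesis"
  \<comment> \<open>The minimum with \<open>d0\<close> keeps the bound \<open>M\<close> valid for
    every term.\<close>
  define d where "d k = min d0 (inverse (real (Suc k)))" for k
  have "d \<longlonglongrightarrow> min d0 0"
    unfolding d_def by (intro tendsto_min tendsto_const LIMSEQ_inverse_real_of_nat)
  then have d_lim: "d \<longlonglongrightarrow> 0" using d0 by (simp add: min_def)
  have d_pos: "0 < d k" for k using d0 by (simp add: d_def)
  define bad where "bad r x1 x2 w1 w2 \<longleftrightarrow> \<not> (\<forall>x\<in>ball xb r.
      f1 x1 + ereal (w1 \<bullet> (x - x1)) \<le> f1 x \<and> f2 x2 + ereal (w2 \<bullet> (x - x2)) \<le> f2 x)" for r x1 x2 w1 w2
  have "\<exists>x1 x2 w1 w2. near_decomposition f1 f2 xb vb (d k) x1 x2 w1 w2 \<and> bad (d k) x1 x2 w1 w2" for k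
    using neg d_pos[of k] unfolding bad_def by blast
  then obtain X1 X2 W1 W2 where near: "\<And>k. near_decomposition f1 f2 xb vb (d k) (X1 k) (X2 k) (W1 k) (W2 k)"
      and bad: "\<And>k. bad (d k) (X1 k) (X2 k) (W1 k) (W2 k)"
    by metis
  note lims = near_decomposition_seq[OF lsc d_lim near]
  have "norm (W1 k) \<le> M" for k
    using bound near_decomposition_mono[OF near, of k d0] by (simp add: d_def)
  then have "bounded (range W1)" by (intro boundedI[of _ M]) auto
  then obtain v1 r where r: "strict_mono r" and v1: "(W1 \<circ> r) \<longlonglongrightarrow> v1"
    using bounded_imp_convergent_subsequence by blast
  note sub = LIMSEQ_subseq_LIMSEQ[OF _ r, unfolded o_def]
  have W1: "(\<lambda>k. W1 (r k)) \<longlonglongrightarrow> v1" using v1 by (simp add: o_def)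
  have "(\<lambda>k. (W1 (r k) + W2 (r k)) - W1 (r k)) \<longlonglongrightarrow> vb - v1"
    by (intro tendsto_diff W1 sub[OF lims(7)])
  then have W2: "(\<lambda>k. W2 (r k)) \<longlonglongrightarrow> vb - v1" by simp
  have "v1 \<in> limiting_subdiff f1 xb"
    by (rule limiting_subdiffI[OF dom(1) sub[OF lims(1)] sub[OF lims(3)] lims(5) W1])
  moreover have "vb - v1 \<in> limiting_subdiff f2 xb"
    by (rule limiting_subdiffI[OF dom(2) sub[OF lims(2)] sub[OF lims(4)] lims(6) W2])
  ultimately have vc': "variationally_convex f1 xb v1" "variationally_convex f2 xb (vb - v1)"
    using vc by auto
  \<comment> \<open>Stated for a generic \<open>f\<close>, to be used for both summands along the
    common subsequence \<open>r\<close>.\<close>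
  have ev: "\<forall>\<^sub>F k in sequentially. \<forall>x\<in>ball xb (d (r k)).
      f (X (r k)) + ereal (W (r k) \<bullet> (x - X (r k))) \<le> f x"
    if vcf: "variationally_convex f xb v" and "f xb \<noteq> \<infinity>" "f xb \<noteq> -\<infinity>" "X \<longlonglongrightarrow> xb" "(\<lambda>k. f (X k)) \<longlonglongrightarrow> f xb"
      and W: "(\<lambda>k. W (r k)) \<longlonglongrightarrow> v" and reg: "\<And>k. W k \<in> regular_subdiff f (X k)"
    for f :: "'a \<Rightarrow> ereal" and X W v
  proof -
    obtain s where s: "0 < s" and unif: "uniform_subgradient_inequality f xb v s"
      using variationally_convex_imp_uniform[OF vcf] .
    have "f xb < f xb + ereal s" using that(2,3) s by (cases "f xb") auto
    then have "\<forall>\<^sub>F k in sequentially. f (X (r k)) < f xb + ereal s"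
      using sub[OF that(5)] by (auto intro: order_tendstoD)
    moreover have "\<forall>\<^sub>F k in sequentially. X (r k) \<in> ball xb s"
      using sub[OF that(4)] s by (intro topological_tendstoD) auto
    moreover have "\<forall>\<^sub>F k in sequentially. W (r k) \<in> ball v s"
      using W s by (intro topological_tendstoD) auto
    moreover have "\<forall>\<^sub>F k in sequentially. d (r k) < s"
      using sub[OF d_lim] s by (rule order_tendstoD)
    ultimately show ?thesis
    proof eventually_elim
      case (elim k)
      then have "ball xb (d (r k)) \<subseteq> ball xb s" by (intro subset_ball) simp
      then show ?case
        using unif elim reg[of "r k"] unfolding uniform_subgradient_inequality_def by blast
    qed
  qed
  have "\<forall>\<^sub>F k in sequentially. \<forall>x\<in>ball xb (d (r k)). f1 (X1 (r k)) + ereal (W1 (r k) \<bullet> (x - X1 (r k))) \<le> f1 x"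
    using ev[OF vc'(1) _ fin(1) lims(1,3) W1 lims(5)] dom(1) by (simp add: edom_def)
  moreover have "\<forall>\<^sub>F k in sequentially. \<forall>x\<in>ball xb (d (r k)). f2 (X2 (r k)) + ereal (W2 (r k) \<bullet> (x - X2 (r k))) \<le> f2 x"
    using ev[OF vc'(2) _ fin(2) lims(2,4) W2 lims(6)] dom(2) by (simp add: edom_def)
  ultimately have "\<forall>\<^sub>F k in sequentially. False"
    by eventually_elim (use bad in \<open>unfold bad_def, blast\<close>)
  then show False by simp
qed

text \<open>Decompositions approaching \<open>(u, v)\<close> are eventually also decompositions near
  \<open>(xb, vb)\<close>, so their two inequalities can be added and passed to the limit.\<close>

lemma uniform_subgradient_inequality_add:
  fixes f1 f2 :: "'a::euclidean_space \<Rightarrow> ereal"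
  assumes lsc: "lsc f1" "lsc f2" and a: "f1 xb = ereal a1" "f2 xb = ereal a2"
    and fin: "\<And>x. f1 x \<noteq> -\<infinity>" "\<And>x. f2 x \<noteq> -\<infinity>"
    and d: "0 < d"
    and bound: "\<And>x1 x2 w1 w2. near_decomposition f1 f2 xb vb d x1 x2 w1 w2 \<Longrightarrow> norm w1 \<le> M"
    and ineq: "\<And>x1 x2 w1 w2 x. near_decomposition f1 f2 xb vb d x1 x2 w1 w2 \<Longrightarrow> x \<in> ball xb d \<Longrightarrow>
      f1 x1 + ereal (w1 \<bullet> (x - x1)) \<le> f1 x \<and> f2 x2 + ereal (w2 \<bullet> (x - x2)) \<le> f2 x"
  obtains s where "0 < s" "uniform_subgradient_inequality (\<lambda>x. f1 x + f2 x) xb vb s"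
proof -
  have near: "\<exists>r>0. \<forall>y\<in>ball xb r. ereal (b - d / 4) < g y" if "lsc g" "g xb = ereal b" for g b
  proof -
    have "ereal (b - d / 4) < g xb" using that(2) d by simp
    then have "\<forall>\<^sub>F y in nhds xb. ereal (b - d / 4) < g y" by (rule lsc_eventually[OF that(1)])
    then show ?thesis by (auto simp: eventually_nhds_metric dist_commute)
  qed
  obtain r1 where r1: "0 < r1" "\<And>y. y \<in> ball xb r1 \<Longrightarrow> ereal (a1 - d / 4) < f1 y"
    using near[OF lsc(1) a(1)] by blast
  obtain r2 where r2: "0 < r2" "\<And>y. y \<in> ball xb r2 \<Longrightarrow> ereal (a2 - d / 4) < f2 y"
    using near[OF lsc(2) a(2)] by blast
  define s where "s = min (d / 4) (min r1 r2)"
  have s: "0 < s" "s \<le> d / 4" "s \<le> r1" "s \<le> r2" using d r1(1) r2(1) by (auto simp: s_def)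
  have "uniform_subgradient_inequality (\<lambda>x. f1 x + f2 x) xb vb s"
    unfolding uniform_subgradient_inequality_def
  proof (intro ballI impI)
    fix u v x
    assume u: "u \<in> ball xb s" and v: "v \<in> ball vb s" and fu: "f1 u + f2 u < f1 xb + f2 xb + ereal s"
      and reg: "v \<in> regular_subdiff (\<lambda>x. f1 x + f2 x) u" and x: "x \<in> ball xb s"
    have low: "ereal (a1 - d / 4) < f1 u" "ereal (a2 - d / 4) < f2 u"
      using r1(2) r2(2) u s by auto
    then obtain b1 b2 where b: "f1 u = ereal b1" "f2 u = ereal b2"
      using fu a by (cases "f1 u"; cases "f2 u") auto
    \<comment> \<open>Closeness of the sum and the lower bound on one summand bound the other from
      above; a further \<open>d / 4\<close> for the approximation still stays below
      \<open>d\<close>.\<close>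
    have b_less: "b1 < a1 + d / 2" "b2 < a2 + d / 2"
      using low fu a b s(2) by simp_all
    define h where "h k = inverse (real (Suc k))" for k
    have h_pos: "0 < h k" for k by (simp add: h_def)
    have h0: "h \<longlonglongrightarrow> 0" unfolding h_def by (rule LIMSEQ_inverse_real_of_nat)
    have "\<exists>x1 x2 w1 w2. near_decomposition f1 f2 u v (h k) x1 x2 w1 w2" for k
      by (rule fuzzy_sum_rule[OF lsc fin reg h_pos])
    then obtain X1 X2 W1 W2 where nd: "\<And>k. near_decomposition f1 f2 u v (h k) (X1 k) (X2 k) (W1 k) (W2 k)"
      by metis
    note lims = near_decomposition_seq[OF lsc h0 nd]
    have close: "\<forall>\<^sub>F k in sequentially. near_decomposition f1 f2 xb vb d (X1 k) (X2 k) (W1 k) (W2 k)"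
    proof -
      have "\<forall>\<^sub>F k in sequentially. h k < d / 4" using h0 by (rule order_tendstoD) (use d in simp)
      then show ?thesis
      proof eventually_elim
        case (elim k)
        have nk: "dist (X1 k) u < d / 4" "dist (X2 k) u < d / 4" "dist (W1 k + W2 k) v < d / 4"
            "f1 (X1 k) < ereal b1 + ereal (d / 4)" "f2 (X2 k) < ereal b2 + ereal (d / 4)"
            "W1 k \<in> regular_subdiff f1 (X1 k)" "W2 k \<in> regular_subdiff f2 (X2 k)"
          using near_decomposition_mono[OF nd[of k], of "d / 4"] elim b
          by (simp_all add: near_decomposition_def)
        have "dist u xb < d / 4" "dist v vb < d / 4" using u v s(2) by (simp_all add: dist_commute)
        then have "dist (X1 k) xb < d" "dist (X2 k) xb < d" "dist (W1 k + W2 k) vb < d"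
          using dist_triangle[of "X1 k" xb u] dist_triangle[of "X2 k" xb u]
            dist_triangle[of "W1 k + W2 k" vb v] nk d by linarith+
        moreover have "f1 (X1 k) < f1 xb + ereal d"
          using nk(4) b_less(1) a d by (cases "f1 (X1 k)") auto
        moreover have "f2 (X2 k) < f2 xb + ereal d"
          using nk(5) b_less(2) a d by (cases "f2 (X2 k)") auto
        ultimately show ?case using nk by (simp add: near_decomposition_def)
      qed
    qed
    \<comment> \<open>The added inequalities are anchored at different points. The mismatch vanishes
      because \<open>W1\<close> is eventually bounded, although neither \<open>W1\<close> nor
      \<open>W2\<close> is known to converge.\<close>
    have "(\<lambda>k. W1 k \<bullet> (X2 k - X1 k)) \<longlonglongrightarrow> 0"
    proof (rule Lim_null_comparison)
      show "\<forall>\<^sub>F k in sequentially. norm (W1 k \<bullet> (X2 k - X1 k)) \<le> M * norm (X2 k - X1 k)"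
        using close
      proof eventually_elim
        case (elim k)
        have "norm (W1 k \<bullet> (X2 k - X1 k)) \<le> norm (W1 k) * norm (X2 k - X1 k)"
          by (simp add: Cauchy_Schwarz_ineq2)
        also have "\<dots> \<le> M * norm (X2 k - X1 k)"
          using bound[OF elim] by (intro mult_right_mono) auto
        finally show ?case .
      qed
      have "(\<lambda>k. M * norm (X2 k - X1 k)) \<longlonglongrightarrow> M * norm (u - u)"
        by (intro tendsto_intros lims)
      then show "(\<lambda>k. M * norm (X2 k - X1 k)) \<longlonglongrightarrow> 0" by simp
    qed
    then have "(\<lambda>k. (W1 k + W2 k) \<bullet> (x - X2 k) + W1 k \<bullet> (X2 k - X1 k)) \<longlonglongrightarrow> v \<bullet> (x - u) + 0"
      by (intro tendsto_add[OF tendsto_inner[OF lims(7)]] tendsto_diff tendsto_const lims(2))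
    then have inner_lim: "(\<lambda>k. ereal ((W1 k + W2 k) \<bullet> (x - X2 k) + W1 k \<bullet> (X2 k - X1 k)))
        \<longlonglongrightarrow> ereal (v \<bullet> (x - u) + 0)"
      by (rule tendsto_ereal)
    have "(\<lambda>k. f1 (X1 k) + f2 (X2 k)) \<longlonglongrightarrow> f1 u + f2 u"
      using lims(3,4) by (rule tendsto_add_ereal_general[rotated]) (simp_all add: b)
    then have "(\<lambda>k. f1 (X1 k) + f2 (X2 k) + ereal ((W1 k + W2 k) \<bullet> (x - X2 k) + W1 k \<bullet> (X2 k - X1 k)))
        \<longlonglongrightarrow> f1 u + f2 u + ereal (v \<bullet> (x - u) + 0)"
      using inner_lim by (rule tendsto_add_ereal_general[rotated]) (simp_all add: b)
    moreover have "\<forall>\<^sub>F k in sequentially. f1 (X1 k) + f2 (X2 k) +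
        ereal ((W1 k + W2 k) \<bullet> (x - X2 k) + W1 k \<bullet> (X2 k - X1 k)) \<le> f1 x + f2 x"
      using close
    proof eventually_elim
      case (elim k)
      have "x \<in> ball xb d" using x s(2) d by simp
      have "(f1 (X1 k) + ereal (W1 k \<bullet> (x - X1 k))) + (f2 (X2 k) + ereal (W2 k \<bullet> (x - X2 k)))
          \<le> f1 x + f2 x"
        using ineq[OF elim \<open>x \<in> ball xb d\<close>] by (simp add: add_mono)
      also have "f1 (X1 k) + ereal (W1 k \<bullet> (x - X1 k)) + (f2 (X2 k) + ereal (W2 k \<bullet> (x - X2 k)))
          = f1 (X1 k) + f2 (X2 k) + ereal (W1 k \<bullet> (x - X1 k) + W2 k \<bullet> (x - X2 k))"
        by (cases "f1 (X1 k)"; cases "f2 (X2 k)") simp_all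
      also have "W1 k \<bullet> (x - X1 k) + W2 k \<bullet> (x - X2 k)
          = (W1 k + W2 k) \<bullet> (x - X2 k) + W1 k \<bullet> (X2 k - X1 k)"
        by (simp add: inner_diff_right inner_add_left)
      finally show ?case .
    qed
    ultimately have "f1 u + f2 u + ereal (v \<bullet> (x - u) + 0) \<le> f1 x + f2 x"
      by (rule tendsto_upperbound) simp
    then show "f1 u + f2 u + ereal (v \<bullet> (x - u)) \<le> f1 x + f2 x" by simp
  qed
  with s(1) show ?thesis by (rule that)
qed

theorem theorem4p9:
  fixes f1 f2 f :: "real ^ 'n \<Rightarrow> ereal" and xb vb :: "real ^ 'n"
  assumes "proper_fun f1" and "lsc f1"
    and "proper_fun f2" and "lsc f2"
    and "f = (\<lambda>x. f1 x + f2 x)"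
    and "xb \<in> edom f1 \<inter> edom f2"
    and "vb \<in> limiting_subdiff f xb"
    and "\<And>v1 v2. v1 \<in> limiting_subdiff f1 xb \<Longrightarrow> v2 \<in> limiting_subdiff f2 xb \<Longrightarrow> vb = v1 + v2 \<Longrightarrow>
           variationally_convex f1 xb v1 \<and> variationally_convex f2 xb v2"
    and "horizon_subdiff f1 xb \<inter> uminus ` horizon_subdiff f2 xb = {0}"
  shows "variationally_convex f xb vb"
proof -
  have fin: "f1 x \<noteq> -\<infinity>" "f2 x \<noteq> -\<infinity>" for x
    using assms(1,3) by (auto simp: proper_fun_def)
  have dom: "xb \<in> edom f1" "xb \<in> edom f2" using assms(6) by auto
  then obtain a1 a2 where a: "f1 xb = ereal a1" "f2 xb = ereal a2"
    using fin(1)[of xb] fin(2)[of xb] by (cases "f1 xb"; cases "f2 xb") (simp_all add: edom_def)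
  have lscf: "lsc f" unfolding assms(5) using lsc_add[OF assms(2,4) fin] .
  have "f x > -\<infinity>" for x
    using fin[of x] by (cases "f1 x"; cases "f2 x") (simp_all add: assms(5))
  moreover have "xb \<in> edom f" using a by (simp add: edom_def assms(5))
  ultimately have pf: "proper_fun f" by (auto simp: proper_fun_def)
  obtain d0 M where d0: "0 < d0"
    and bound: "\<And>x1 x2 w1 w2. near_decomposition f1 f2 xb vb d0 x1 x2 w1 w2 \<Longrightarrow> norm w1 \<le> M"
    using near_decomposition_bounded[OF assms(2,4) dom assms(9)] by blast
  have "\<exists>d>0. \<forall>x1 x2 w1 w2. near_decomposition f1 f2 xb vb d x1 x2 w1 w2 \<longrightarrow>
    (\<forall>x\<in>ball xb d. f1 x1 + ereal (w1 \<bullet> (x - x1)) \<le> f1 x \<and> f2 x2 + ereal (w2 \<bullet> (x - x2)) \<le> f2 x)"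
    by (rule near_decomposition_subgradient_inequality[OF assms(2,4) dom fin _ d0])
      (fact assms(8), fact bound)
  then obtain d1 where d1: "0 < d1"
    and ineq: "\<And>x1 x2 w1 w2 x. near_decomposition f1 f2 xb vb d1 x1 x2 w1 w2 \<Longrightarrow> x \<in> ball xb d1 \<Longrightarrow>
      f1 x1 + ereal (w1 \<bullet> (x - x1)) \<le> f1 x \<and> f2 x2 + ereal (w2 \<bullet> (x - x2)) \<le> f2 x"
    by blast
  \<comment> \<open>Both the bound and the inequalities survive shrinking the tolerance.\<close>
  define d where "d = min d0 d1"
  have d: "0 < d" "d \<le> d0" "d \<le> d1" using d0 d1 by (simp_all add: d_def)
  obtain s where "0 < s" "uniform_subgradient_inequality (\<lambda>x. f1 x + f2 x) xb vb s"
  proof (rule uniform_subgradient_inequality_add[OF assms(2,4) a fin d(1)])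
    show "norm w1 \<le> M" if "near_decomposition f1 f2 xb vb d x1 x2 w1 w2" for x1 x2 w1 w2
      using bound near_decomposition_mono[OF that d(2)] .
    show "f1 x1 + ereal (w1 \<bullet> (x - x1)) \<le> f1 x \<and> f2 x2 + ereal (w2 \<bullet> (x - x2)) \<le> f2 x"
      if "near_decomposition f1 f2 xb vb d x1 x2 w1 w2" "x \<in> ball xb d" for x1 x2 w1 w2 x
      using ineq near_decomposition_mono[OF that(1) d(3)] that(2) d(3) by simp
  qed
  then show ?thesis
    by (intro variationally_convexI[OF pf lscf assms(7)]) (simp_all add: assms(5))
qed

end
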